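(* Let $1\le p\le2$, $1\le q\le\infty$ and $s,\varrho>0$. Then there cannot exist a reconstruction method (i.e. an arbitrary, linear or nonlinear, map) $R:L^2(\mathbb T^d)\to B^0_{p,q}(\mathbb T^d)$ for the backward heat equation such that $$\sup\Big\{\|f-R(g^{\mathrm{obs}})\|_{B^0_{p,q}}:\ \|f\|_{B^s_{p,\infty}}\le\varrho,\ g^{\mathrm{obs}}\in L^2(\mathbb T^d),\ \|T_{\mathrm{BH}}f-g^{\mathrm{obs}}\|_{L^2}\le\delta\Big\}=o\Big(\varrho\Big(\ln\frac\varrho\delta\Big)^{-s/2}\Big)\qquad\text{as }\delta\to0.$$ Hence the convergence rate $\|\widehat f_\alpha-f^\dagger\|_{B^0_{p,q}}\le c\,\varrho\big(\ln\frac\varrho\delta\big)^{-s/2}$ of Tikhonov regularization for the backwards heat equation with penalty $\frac1r\|\cdot\|^r_{B^0_{p,q},\mathcal W}$ (described in the context) is optimal for $q\ge2$ as $\delta\to0$ up to the value of the constant.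
   Context: $\mathbb T^d=\mathbb R^d/\mathbb Z^d$ and $B^s_{p,q}=B^s_{p,q}(\mathbb T^d)$ are the Besov spaces on the torus with any fixed equivalent norms. For fixed $\bar t>0$, $T_{\mathrm{BH}}f=u(\cdot,\bar t)$, where $u$ solves $\partial_tu=\Delta u$ in $\mathbb T^d\times(0,\bar t)$ with $u(\cdot,0)=f$ on $\mathbb T^d$. The Tikhonov rate whose optimality is asserted is the following upper bound. Let $p\in(1,2]$, $q\in[2,\infty)$, $s>0$, $r=\max\{2,p,q\}$, $r'$ its Hölder conjugate, and $\mathcal R=\frac1r\|\cdot\|^r_{B^0_{p,q},\mathcal W}$, where $\|\cdot\|_{B^0_{p,q},\mathcal W}$ is the equivalent norm $$\|f\|_{B^0_{p,q},\mathcal W}=\Big[\sum_{j\in\mathbb N_0}2^{jd(\frac12-\frac1p)q}\Big(\sum_{l\in I_j}|\langle f,\phi_{j,l}\rangle|^p\Big)^{q/p}\Big]^{1/q}$$ built from a fixed, sufficiently smooth orthonormal wavelet system $(\phi_{j,l})_{j\in\mathbb N_0,\,l\in I_j}$ of $L^2(\mathbb T^d)$ that generates the Besov spaces (e.g. periodized Daubechies or Meyer wavelets). Let $\mathcal D\subset B^0_{p,q}$ be nonempty, closed and convex, $f^\dagger\in\mathcal D\cap B^s_{p,\infty}$ with $\|f^\dagger\|_{B^s_{p,\infty}}\le\varrho$, and $g^{\mathrm{obs}}=T_{\mathrm{BH}}f^\dagger+\xi$ with $\|\xi\|_{L^2}\le\delta$. Let $\widehat f_\alpha$ be the minimizer over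 $\mathcal D$ of $f\mapsto\frac12\|T_{\mathrm{BH}}f\|_{L^2}^2-\langle g^{\mathrm{obs}},T_{\mathrm{BH}}f\rangle+\alpha\mathcal R(f)$, with $\alpha$ chosen such that $-\frac1{4\alpha}\in\partial(-\psi)(4\delta^2)$, where for a constant $c_0>0$ $$\psi(\tau)=c_0\varrho^r\Big[\frac{\sqrt\tau}\varrho\Big(3+\frac\varrho{\sqrt\tau}\Big)^{1/2}+\Big(\ln\Big(\Big(3+\frac\varrho{\sqrt\tau}\Big)^{1/2}\Big)\Big)^{-s(q-1)r'/2}\Big]$$ is the index function of a variational source condition satisfied by $f^\dagger$, namely $\langle f^*,f^\dagger-f\rangle\le\frac12\Delta_{\mathcal R}(f,f^\dagger)+\psi(\|T_{\mathrm{BH}}f^\dagger-T_{\mathrm{BH}}f\|_{L^2}^2)$ for all $f\in\mathcal D$, with $f^*\in\partial\mathcal R(f^\dagger)$ and $\Delta_{\mathcal R}(f,f^\dagger)=\mathcal R(f)-\mathcal R(f^\dagger)-\langle f^*,f-f^\dagger\rangle$. Then $\|\widehat f_\alpha-f^\dagger\|_{B^0_{p,q}}\le c\,\varrho(\ln\frac\varrho\delta)^{-s/2}$ as $\delta\to0$, with $c>0$ independent of $f^\dagger$, $\delta$ and $\varrho$. *)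

theory Defs
  imports "HOL-Analysis.Analysis"
begin

section \<open>Functions and distributions on the torus\<close>

text \<open>Functions on the \<open>d\<close>-dimensional torus are functions on \<open>real^'d\<close> that have period 1 in
  every coordinate; integrals over the torus are integrals over the unit cube.\<close>

definition torus_periodic :: "(real^'d \<Rightarrow> 'b) \<Rightarrow> bool" where
  "torus_periodic g \<longleftrightarrow> (\<forall>x i. g (x + axis i 1) = g x)"

definition torus :: "(real^'d) measure" where
  "torus = lebesgue_on (cbox 0 1)"

definition Lp_norm :: "real \<Rightarrow> (real^'d \<Rightarrow> 'b::real_normed_vector) \<Rightarrow> real" where
  "Lp_norm p g = (LINT x|torus. norm (g x) powr p) powr (1 / p)"

definition L2_fun :: "(real^'d \<Rightarrow> real) \<Rightarrow> bool" where
  "L2_fun g \<longleftrightarrow> torus_periodic g \<and> g \<in> borel_measurable lebesgue \<and>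
     integrable torus (\<lambda>x. (g x)\<^sup>2)"

definition L2_inner :: "(real^'d \<Rightarrow> real) \<Rightarrow> (real^'d \<Rightarrow> real) \<Rightarrow> real" where
  "L2_inner g h = (LINT x|torus. g x * h x)"

definition partial :: "'d \<Rightarrow> (real^'d \<Rightarrow> real) \<Rightarrow> real^'d \<Rightarrow> real" where
  "partial i g x = deriv (\<lambda>h. g (x + h *\<^sub>R axis i 1)) 0"

primrec partials :: "'d list \<Rightarrow> (real^'d \<Rightarrow> real) \<Rightarrow> real^'d \<Rightarrow> real" where
  "partials [] g = g"
| "partials (i # ds) g = partial i (partials ds g)"

text \<open>The class \<open>C^m\<close>: all iterated partial derivatives of order at most \<open>m\<close>, in every order of
  differentiation, exist and are continuous.\<close>

definition Ck :: "nat \<Rightarrow> (real^'d \<Rightarrow> real) \<Rightarrow> bool" where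
  "Ck m g \<longleftrightarrow>
     (\<forall>ds. length ds \<le> m \<longrightarrow> continuous_on UNIV (partials ds g)) \<and>
     (\<forall>ds i x. length ds < m \<longrightarrow>
        (\<lambda>h. partials ds g (x + h *\<^sub>R axis i 1)) field_differentiable (at 0))"

definition test_fun :: "(real^'d \<Rightarrow> real) \<Rightarrow> bool" where
  "test_fun \<phi> \<longleftrightarrow> torus_periodic \<phi> \<and> (\<forall>m. Ck m \<phi>)"

text \<open>Real periodic distributions: linear functionals on the smooth periodic functions that are
  bounded by some \<open>C^m\<close>-norm. The value 0 off the test functions makes equality of HOL functions
  coincide with equality of distributions. Sums, multiples and differences of distributions are
  formed pointwise.\<close>

type_synonym 'd distribution = "(real^'d \<Rightarrow> real) \<Rightarrow> real"

definition distributions :: "('d::finite) distribution set" where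
  "distributions = {u.
     (\<forall>\<phi> \<theta>. test_fun \<phi> \<and> test_fun \<theta> \<longrightarrow> u (\<lambda>x. \<phi> x + \<theta> x) = u \<phi> + u \<theta>) \<and>
     (\<forall>c \<phi>. test_fun \<phi> \<longrightarrow> u (\<lambda>x. c * \<phi> x) = c * u \<phi>) \<and>
     (\<exists>m C. \<forall>\<phi> M. test_fun \<phi> \<and> (\<forall>ds x. length ds \<le> m \<longrightarrow> \<bar>partials ds \<phi> x\<bar> \<le> M)
        \<longrightarrow> \<bar>u \<phi>\<bar> \<le> C * M) \<and>
     (\<forall>\<phi>. \<not> test_fun \<phi> \<longrightarrow> u \<phi> = 0)}"

section \<open>Besov spaces\<close>

definition freq :: "int^'d \<Rightarrow> real^'d" where
  "freq k = (\<chi> i. of_int (k $ i))"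

text \<open>\<open>u\<close> applied to \<open>exp (-2 \<pi> i k \<bullet> x)\<close>, split into real and imaginary part because
  distributions act on real test functions.\<close>

definition fourier_coeff :: "('d::finite) distribution \<Rightarrow> int^'d \<Rightarrow> complex" where
  "fourier_coeff u k =
     Complex (u (\<lambda>x. cos (2 * pi * (freq k \<bullet> x)))) (- u (\<lambda>x. sin (2 * pi * (freq k \<bullet> x))))"

definition lp_cutoff :: "(real^'d \<Rightarrow> real) \<Rightarrow> bool" where
  "lp_cutoff \<eta> \<longleftrightarrow> (\<forall>m. Ck m \<eta>) \<and> (\<forall>x. \<eta> (- x) = \<eta> x) \<and>
     (\<forall>x. norm x \<le> 1 \<longrightarrow> \<eta> x = 1) \<and> (\<forall>x. norm x \<ge> 2 \<longrightarrow> \<eta> x = 0)"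

primrec dyadic :: "(real^'d \<Rightarrow> real) \<Rightarrow> nat \<Rightarrow> real^'d \<Rightarrow> real" where
  "dyadic \<eta> 0 = \<eta>"
| "dyadic \<eta> (Suc j) = (\<lambda>x. \<eta> (x /\<^sub>R 2 ^ Suc j) - \<eta> (x /\<^sub>R 2 ^ j))"

definition lp_block ::
  "(real^'d \<Rightarrow> real) \<Rightarrow> nat \<Rightarrow> ('d::finite) distribution \<Rightarrow> real^'d \<Rightarrow> complex" where
  "lp_block \<eta> j u x =
     (\<Sum>k | dyadic \<eta> j (freq k) \<noteq> 0.
        of_real (dyadic \<eta> j (freq k)) * fourier_coeff u k * cis (2 * pi * (freq k \<bullet> x)))"

definition lq_mem :: "ereal \<Rightarrow> (nat \<Rightarrow> real) \<Rightarrow> bool" where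
  "lq_mem q a \<longleftrightarrow> (if q = \<infinity> then bdd_above (range (\<lambda>j. \<bar>a j\<bar>))
     else summable (\<lambda>j. \<bar>a j\<bar> powr real_of_ereal q))"

definition lq_norm :: "ereal \<Rightarrow> (nat \<Rightarrow> real) \<Rightarrow> real" where
  "lq_norm q a = (if q = \<infinity> then SUP j. \<bar>a j\<bar>
     else (\<Sum>j. \<bar>a j\<bar> powr real_of_ereal q) powr (1 / real_of_ereal q))"

definition besov_seq ::
  "(real^'d \<Rightarrow> real) \<Rightarrow> real \<Rightarrow> real \<Rightarrow> ('d::finite) distribution \<Rightarrow> nat \<Rightarrow> real" where
  "besov_seq \<eta> s p u j = 2 powr (real j * s) * Lp_norm p (lp_block \<eta> j u)"

definition besov_space ::
  "(real^'d \<Rightarrow> real) \<Rightarrow> real \<Rightarrow> real \<Rightarrow> ereal \<Rightarrow> ('d::finite) distribution set" where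
  "besov_space \<eta> s p q = {u \<in> distributions. lq_mem q (besov_seq \<eta> s p u)}"

definition besov_norm ::
  "(real^'d \<Rightarrow> real) \<Rightarrow> real \<Rightarrow> real \<Rightarrow> ereal \<Rightarrow> ('d::finite) distribution \<Rightarrow> real" where
  "besov_norm \<eta> s p q u = lq_norm q (besov_seq \<eta> s p u)"

definition equivalent_besov_norm ::
  "(real^'d \<Rightarrow> real) \<Rightarrow> real \<Rightarrow> real \<Rightarrow> ereal \<Rightarrow> (('d::finite) distribution \<Rightarrow> real) \<Rightarrow> bool" where
  "equivalent_besov_norm \<eta> s p q N \<longleftrightarrow>
     (\<forall>u \<in> besov_space \<eta> s p q. \<forall>v \<in> besov_space \<eta> s p q. N (\<lambda>\<phi>. u \<phi> + v \<phi>) \<le> N u + N v) \<and>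
     (\<forall>c. \<forall>u \<in> besov_space \<eta> s p q. N (\<lambda>\<phi>. c * u \<phi>) = \<bar>c\<bar> * N u) \<and>
     (\<exists>a>0. \<exists>b>0. \<forall>u \<in> besov_space \<eta> s p q.
        a * besov_norm \<eta> s p q u \<le> N u \<and> N u \<le> b * besov_norm \<eta> s p q u)"

section \<open>The backward heat equation\<close>

text \<open>Classical solutions in the interior of the time interval, continuous up to the final time,
  and attaining the (distributional) initial value in the sense of distributions.\<close>

definition heat_solution ::
  "real \<Rightarrow> ('d::finite) distribution \<Rightarrow> (real \<Rightarrow> real^'d \<Rightarrow> real) \<Rightarrow> bool" where
  "heat_solution tbar f u \<longleftrightarrow>
     (\<forall>t\<in>{0<..tbar}. torus_periodic (u t)) \<and>
     continuous_on ({0<..tbar} \<times> UNIV) (\<lambda>(t, x). u t x) \<and>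
     (\<forall>t\<in>{0<..<tbar}. Ck 2 (u t)) \<and>
     (\<forall>ds. length ds \<le> 2 \<longrightarrow>
        continuous_on ({0<..<tbar} \<times> UNIV) (\<lambda>(t, x). partials ds (u t) x)) \<and>
     (\<forall>t\<in>{0<..<tbar}. \<forall>x.
        ((\<lambda>\<tau>. u \<tau> x) has_real_derivative (\<Sum>i\<in>UNIV. partials [i, i] (u t) x)) (at t)) \<and>
     (\<forall>\<phi>. test_fun \<phi> \<longrightarrow> ((\<lambda>t. L2_inner (u t) \<phi>) \<longlongrightarrow> f \<phi>) (at_right 0))"

definition heat_operator ::
  "real \<Rightarrow> ('d::finite) distribution set \<Rightarrow> ('d distribution \<Rightarrow> real^'d \<Rightarrow> real) \<Rightarrow> bool" where
  "heat_operator tbar V T \<longleftrightarrow> (\<forall>f\<in>V. \<exists>u. heat_solution tbar f u \<and> T f = u tbar)"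

section \<open>Reconstruction methods and their worst case error\<close>

text \<open>A map from \<open>L^2\<close> to \<open>V\<close>: the last conjunct says that the map is well defined on classes of
  functions modulo equality almost everywhere. No further property is required.\<close>

definition reconstruction_method ::
  "('d::finite) distribution set \<Rightarrow> ((real^'d \<Rightarrow> real) \<Rightarrow> 'd distribution) \<Rightarrow> bool" where
  "reconstruction_method V R \<longleftrightarrow> (\<forall>g. L2_fun g \<longrightarrow> R g \<in> V) \<and>
     (\<forall>g h. L2_fun g \<and> L2_fun h \<and> (AE x in torus. g x = h x) \<longrightarrow> R g = R h)"

text \<open>Here \<open>N\<close> is the norm in which the error is measured, and \<open>S\<close>, \<open>NS\<close> are the smoothness space
  and its norm. The supremum may be infinite.\<close>

definition worst_case_error ::
  "(('d::finite) distribution \<Rightarrow> real) \<Rightarrow> 'd distribution set \<Rightarrow> ('d distribution \<Rightarrow> real) \<Rightarrow>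
   ('d distribution \<Rightarrow> real^'d \<Rightarrow> real) \<Rightarrow> real \<Rightarrow> real \<Rightarrow>
   ((real^'d \<Rightarrow> real) \<Rightarrow> 'd distribution) \<Rightarrow> ereal" where
  "worst_case_error N S NS T \<rho> \<delta> R =
     Sup {ereal (N (f - R g)) | f g.
       f \<in> S \<and> NS f \<le> \<rho> \<and> L2_fun g \<and> Lp_norm 2 (T f - g) \<le> \<delta>}"

definition little_o_at_0 :: "(real \<Rightarrow> ereal) \<Rightarrow> (real \<Rightarrow> real) \<Rightarrow> bool" where
  "little_o_at_0 E r \<longleftrightarrow> (\<forall>\<epsilon>>0. \<forall>\<^sub>F \<delta> in at_right 0. E \<delta> \<le> ereal (\<epsilon> * r \<delta>))"

definition log_rate :: "real \<Rightarrow> real \<Rightarrow> real \<Rightarrow> real" where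
  "log_rate s \<rho> \<delta> = \<rho> * ln (\<rho> / \<delta>) powr (- s / 2)"

section \<open>Wavelet norms\<close>

text \<open>\<open>W j l\<close> for \<open>l \<in> I j\<close> are the wavelets: a real orthonormal basis of \<open>L^2\<close> of the torus. Since
  wavelets such as those of Daubechies are only finitely often differentiable, the pairing with a
  distribution \<open>u\<close> is the extension of the \<open>L^2\<close> inner product given by the Littlewood-Paley
  decomposition of \<open>u\<close>.\<close>

definition orthonormal_system :: "(nat \<Rightarrow> 'l set) \<Rightarrow> (nat \<Rightarrow> 'l \<Rightarrow> real^'d \<Rightarrow> real) \<Rightarrow> bool" where
  "orthonormal_system I W \<longleftrightarrow>
     (\<forall>j. finite (I j)) \<and>
     (\<forall>j. \<forall>l\<in>I j. torus_periodic (W j l) \<and> continuous_on UNIV (W j l)) \<and>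
     (\<forall>j j'. \<forall>l\<in>I j. \<forall>l'\<in>I j'.
        L2_inner (W j l) (W j' l') = (if j = j' \<and> l = l' then 1 else 0)) \<and>
     (\<forall>g. L2_fun g \<and> (\<forall>j. \<forall>l\<in>I j. L2_inner g (W j l) = 0) \<longrightarrow> (AE x in torus. g x = 0))"

definition pairing_summands ::
  "(real^'d \<Rightarrow> real) \<Rightarrow> ('d::finite) distribution \<Rightarrow> (real^'d \<Rightarrow> real) \<Rightarrow> nat \<Rightarrow> real" where
  "pairing_summands \<eta> u w n = L2_inner (\<lambda>x. Re (lp_block \<eta> n u x)) w"

definition pairing ::
  "(real^'d \<Rightarrow> real) \<Rightarrow> ('d::finite) distribution \<Rightarrow> (real^'d \<Rightarrow> real) \<Rightarrow> real" where
  "pairing \<eta> u w = (\<Sum>n. pairing_summands \<eta> u w n)"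

definition wavelet_seq ::
  "(real^'d \<Rightarrow> real) \<Rightarrow> (nat \<Rightarrow> 'l set) \<Rightarrow> (nat \<Rightarrow> 'l \<Rightarrow> real^'d \<Rightarrow> real) \<Rightarrow> real \<Rightarrow> real \<Rightarrow>
   ('d::finite) distribution \<Rightarrow> nat \<Rightarrow> real" where
  "wavelet_seq \<eta> I W s p u j =
     2 powr (real j * (s + real CARD('d) * (1/2 - 1/p))) *
     (\<Sum>l\<in>I j. \<bar>pairing \<eta> u (W j l)\<bar> powr p) powr (1 / p)"

definition wavelet_norm ::
  "(real^'d \<Rightarrow> real) \<Rightarrow> (nat \<Rightarrow> 'l set) \<Rightarrow> (nat \<Rightarrow> 'l \<Rightarrow> real^'d \<Rightarrow> real) \<Rightarrow> real \<Rightarrow> real \<Rightarrow> ereal \<Rightarrow>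
   ('d::finite) distribution \<Rightarrow> real" where
  "wavelet_norm \<eta> I W s p q u = lq_norm q (wavelet_seq \<eta> I W s p u)"

text \<open>The system is smooth enough for the pairing with elements of the Besov space to be defined,
  and the wavelet norm is an equivalent norm.\<close>

definition generates_besov ::
  "(real^'d \<Rightarrow> real) \<Rightarrow> (nat \<Rightarrow> 'l set) \<Rightarrow> (nat \<Rightarrow> 'l \<Rightarrow> real^'d \<Rightarrow> real) \<Rightarrow> real \<Rightarrow> real \<Rightarrow> ereal \<Rightarrow>
   bool" where
  "generates_besov \<eta> I W s p q \<longleftrightarrow>
     (\<forall>u \<in> besov_space \<eta> s p q.
        (\<forall>j. \<forall>l\<in>I j. summable (pairing_summands \<eta> u (W j l))) \<and>
        lq_mem q (wavelet_seq \<eta> I W s p u)) \<and>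
     equivalent_besov_norm \<eta> s p q (wavelet_norm \<eta> I W s p q)"

section \<open>Tikhonov regularization\<close>

definition admissible_domain ::
  "('d::finite) distribution set \<Rightarrow> ('d distribution \<Rightarrow> real) \<Rightarrow> 'd distribution set \<Rightarrow> bool" where
  "admissible_domain V N D \<longleftrightarrow> D \<subseteq> V \<and> D \<noteq> {} \<and>
     (\<forall>f\<in>D. \<forall>g\<in>D. \<forall>\<theta>\<in>{0..1}. (\<lambda>\<phi>. (1 - \<theta>) * f \<phi> + \<theta> * g \<phi>) \<in> D) \<and>
     (\<forall>F f. (\<forall>n::nat. F n \<in> D) \<and> f \<in> V \<and> (\<lambda>n. N (F n - f)) \<longlonglongrightarrow> 0 \<longrightarrow> f \<in> D)"

definition penalty ::
  "(('d::finite) distribution \<Rightarrow> real) \<Rightarrow> real \<Rightarrow> 'd distribution \<Rightarrow> real" where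
  "penalty NW r f = 1 / r * NW f powr r"

text \<open>\<open>F\<close> lies in the subdifferential of \<open>P\<close> at \<open>f\<close>, as an element of the dual of \<open>(V, N)\<close>.\<close>

definition subgradient ::
  "('d::finite) distribution set \<Rightarrow> ('d distribution \<Rightarrow> real) \<Rightarrow> ('d distribution \<Rightarrow> real) \<Rightarrow>
   'd distribution \<Rightarrow> ('d distribution \<Rightarrow> real) \<Rightarrow> bool" where
  "subgradient V N P f F \<longleftrightarrow>
     (\<forall>u\<in>V. \<forall>v\<in>V. F (\<lambda>\<phi>. u \<phi> + v \<phi>) = F u + F v) \<and>
     (\<forall>c. \<forall>u\<in>V. F (\<lambda>\<phi>. c * u \<phi>) = c * F u) \<and>
     (\<exists>C. \<forall>u\<in>V. \<bar>F u\<bar> \<le> C * N u) \<and>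
     (\<forall>u\<in>V. P u \<ge> P f + F (u - f))"

definition bregman ::
  "(('d::finite) distribution \<Rightarrow> real) \<Rightarrow> ('d distribution \<Rightarrow> real) \<Rightarrow> 'd distribution \<Rightarrow>
   'd distribution \<Rightarrow> real" where
  "bregman P F f fdag = P f - P fdag - F (f - fdag)"

text \<open>The value at 0 is the limit; the formula itself would yield something else there, because
  division by 0 gives 0 in HOL.\<close>

definition index_fun :: "real \<Rightarrow> real \<Rightarrow> real \<Rightarrow> real \<Rightarrow> real \<Rightarrow> real \<Rightarrow> real" where
  "index_fun c0 \<rho> s q r \<tau> =
     (if \<tau> = 0 then 0
      else c0 * \<rho> powr r *
        (sqrt \<tau> / \<rho> * (3 + \<rho> / sqrt \<tau>) powr (1/2)
         + ln ((3 + \<rho> / sqrt \<tau>) powr (1/2)) powr (- (s * (q - 1) * (r / (r - 1)) / 2))))"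

definition source_condition ::
  "('d::finite) distribution set \<Rightarrow> ('d distribution \<Rightarrow> real^'d \<Rightarrow> real) \<Rightarrow>
   ('d distribution \<Rightarrow> real) \<Rightarrow> (real \<Rightarrow> real) \<Rightarrow> 'd distribution \<Rightarrow> ('d distribution \<Rightarrow> real) \<Rightarrow>
   bool" where
  "source_condition D T P \<psi> fdag F \<longleftrightarrow>
     (\<forall>f\<in>D. F (fdag - f) \<le> 1/2 * bregman P F f fdag + \<psi> ((Lp_norm 2 (T fdag - T f))\<^sup>2))"

text \<open>Subdifferential of a function on \<open>[0,\<infinity>)\<close>, extended by \<open>+\<infinity>\<close> to the negative reals.\<close>

definition subdifferential :: "(real \<Rightarrow> real) \<Rightarrow> real \<Rightarrow> real set" where
  "subdifferential h x = {v. \<forall>y\<ge>0. h y \<ge> h x + v * (y - x)}"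

definition tikhonov_functional ::
  "(('d::finite) distribution \<Rightarrow> real^'d \<Rightarrow> real) \<Rightarrow> ('d distribution \<Rightarrow> real) \<Rightarrow> real \<Rightarrow>
   (real^'d \<Rightarrow> real) \<Rightarrow> 'd distribution \<Rightarrow> real" where
  "tikhonov_functional T P \<alpha> g f =
     1/2 * (Lp_norm 2 (T f))\<^sup>2 - L2_inner g (T f) + \<alpha> * P f"

definition tikhonov_minimizer ::
  "('d::finite) distribution set \<Rightarrow> ('d distribution \<Rightarrow> real^'d \<Rightarrow> real) \<Rightarrow>
   ('d distribution \<Rightarrow> real) \<Rightarrow> real \<Rightarrow> (real^'d \<Rightarrow> real) \<Rightarrow> 'd distribution \<Rightarrow> bool" where
  "tikhonov_minimizer D T P \<alpha> g fhat \<longleftrightarrow>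
     is_arg_min (tikhonov_functional T P \<alpha> g) (\<lambda>f. f \<in> D) fhat"

end

theory Submission
  imports Defs
begin

text \<open>Lower bound: \<open>f = A cos (2 \<pi> 2\<^sup>n x\<^sub>i)\<close> and \<open>- f\<close>, with \<open>A\<close> proportional to
  \<open>\<rho> 2\<^bsup>-ns\<^esup>\<close>, are admissible, and the heat flow shrinks both below
  \<open>\<delta> \<sim> \<rho> exp (- 4 \<pi>\<^sup>2 4\<^sup>n t)\<close>. For the data 0 every method therefore errs by at least the norm
  of \<open>f\<close> on one of them, which is of the order of \<open>A \<sim> \<rho> (ln (\<rho>/\<delta>))\<^bsup>-s/2\<^esup>\<close>. The only delicate
  point is that the solution of the heat equation with initial value \<open>f\<close> is unique: its Fourier
  coefficients solve a linear differential equation, and Stone-Weierstrass gives completeness of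
  the trigonometric system.

  Tikhonov rate: the variational source condition and the choice of \<open>\<alpha>\<close> bound the Bregman distance
  by \<open>2 \<psi>(4 \<delta>\<^sup>2)\<close>. For \<open>1 < p \<le> 2 \<le> q\<close> the \<open>q\<close>-th power of the wavelet norm is uniformly
  convex of power type \<open>q\<close>, so that the Bregman distance dominates the \<open>q\<close>-th power of the error,
  and the \<open>q\<close>-th root of \<open>\<psi>(4 \<delta>\<^sup>2)\<close> has the asserted size.\<close>

section \<open>Integrals over the torus\<close>

text \<open>The operator \<open>T\<close> is only known to return some heat solution at the final
  time; linearity and boundedness are not given. So uniqueness must be proved, but for a single
  Fourier mode only. The modes have frequencies of modulus \<open>2 ^ n\<close> because there the
  Littlewood-Paley cutoffs isolate one block: the Besov norms for all smoothness and summation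
  indices are then explicit up to a factor 2, and equivalent norms cost constants alone. In the
  second half r = q, since p \<le> 2 \<le> q. The exponent s(q-1)r'/2 in \<psi> is then sq/2, and
  the q-th root leaves the s/2 of the rate. Uniform convexity is needed at midpoints only, because
  the subgradient inequality can be tested there. For l^p with p \<le> 2 it rests on a scalar fact:
  the second derivative of the p-th power is bounded below on bounded intervals. This yields a
  quadratic gain with a weight depending on the coordinates, and Hoelder's inequality removes the
  weight. The constant degenerates as p tends to 1.\<close>

lemma torus_integral_split:
  fixes h :: "real^'d \<Rightarrow> real"
  assumes c: "0 \<le> c" "c \<le> 1" and h: "continuous_on UNIV h"
  shows "integral (cbox 0 1) h =
    integral (cbox 0 (\<chi> j. if j = i then c else 1)) h +
    integral (cbox (\<chi> j. if j = i then c else 0) 1) h"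
proof -
  have "h integrable_on cbox 0 1"
    by (intro integrable_continuous continuous_on_subset[OF h]) auto
  from integral_split[OF this, of "axis i 1" c]
  have "integral (cbox 0 1) h =
      integral (cbox 0 1 \<inter> {x. x $ i \<le> c}) h + integral (cbox 0 1 \<inter> {x. c \<le> x $ i}) h"
    by (simp add: inner_axis)
  moreover have "cbox 0 1 \<inter> {x. x $ i \<le> c} = cbox 0 (\<chi> j. if j = i then c else 1)"
    using c by (simp add: set_eq_iff mem_box_cart) (smt (verit))
  moreover have "cbox 0 1 \<inter> {x. c \<le> x $ i} = cbox (\<chi> j. if j = i then c else 0) 1"
    using c by (simp add: set_eq_iff mem_box_cart) (smt (verit))
  ultimately show ?thesis by simp
qed

text \<open>Cut the cube at \<open>1 - t\<close>: the part with larger i-th coordinate leaves the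
  cube under the shift, and periodicity moves it back by one unit onto the slab that the shift has
  vacated.\<close>

lemma torus_integral_translate:
  fixes h :: "real^'d \<Rightarrow> real"
  assumes h: "continuous_on UNIV h" "torus_periodic h" and t: "0 \<le> t" "t \<le> 1"
  shows "integral (cbox 0 1) (\<lambda>x. h (x + t *\<^sub>R axis i 1)) = integral (cbox 0 1) h"
proof -
  let ?e = "axis i 1 :: real^'d"
  define U :: "real \<Rightarrow> real^'d" where "U c = (\<chi> j. if j = i then c else 1)" for c
  define L :: "real \<Rightarrow> real^'d" where "L c = (\<chi> j. if j = i then c else 0)" for c
  have per: "h (x + t *\<^sub>R ?e) = h (x + (t - 1) *\<^sub>R ?e)" for x
  proof -
    have "h ((x + (t - 1) *\<^sub>R ?e) + ?e) = h (x + (t - 1) *\<^sub>R ?e)"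
      using h(2) by (simp add: torus_periodic_def)
    then show ?thesis by (simp add: algebra_simps)
  qed
  have cont: "continuous_on UNIV (\<lambda>x. h (x + t *\<^sub>R ?e))"
    by (intro continuous_on_compose2[OF h(1)] continuous_intros) auto
  have "integral (cbox 0 1) (\<lambda>x. h (x + t *\<^sub>R ?e)) =
      integral (cbox 0 (U (1 - t))) (\<lambda>x. h (x + t *\<^sub>R ?e)) +
      integral (cbox (L (1 - t)) 1) (\<lambda>x. h (x + (t - 1) *\<^sub>R ?e))"
    using torus_integral_split[OF _ _ cont, of "1 - t" i] t by (simp add: U_def L_def per)
  also have "integral (cbox 0 (U (1 - t))) (\<lambda>x. h (x + t *\<^sub>R ?e)) = integral (cbox (L t) 1) h"
  proof -
    have "0 + t *\<^sub>R ?e = L t" "U (1 - t) + t *\<^sub>R ?e = 1"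
      by (auto simp: L_def U_def vec_eq_iff axis_def)
    then show ?thesis
      using integral_shift_cbox_plus[of 0 "U (1 - t)" h "t *\<^sub>R ?e"] by (simp add: o_def add.commute)
  qed
  also have "integral (cbox (L (1 - t)) 1) (\<lambda>x. h (x + (t - 1) *\<^sub>R ?e)) = integral (cbox 0 (U t)) h"
  proof -
    have "L (1 - t) + (t - 1) *\<^sub>R ?e = 0" "1 + (t - 1) *\<^sub>R ?e = U t"
      by (auto simp: L_def U_def vec_eq_iff axis_def)
    then show ?thesis
      using integral_shift_cbox_plus[of "L (1 - t)" 1 h "(t - 1) *\<^sub>R ?e"] by (simp add: o_def add.commute)
  qed
  also have "integral (cbox (L t) 1) h + integral (cbox 0 (U t)) h = integral (cbox 0 1) h"
    using torus_integral_split[OF t h(1), of i] by (simp add: U_def L_def)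
  finally show ?thesis .
qed

text \<open>Translations preserve the integral; differentiate this at 0.\<close>

lemma torus_integral_derivative:
  fixes h h' :: "real^'d \<Rightarrow> real"
  assumes h: "continuous_on UNIV h" "torus_periodic h" and h': "continuous_on UNIV h'"
    and d: "\<And>x. ((\<lambda>t. h (x + t *\<^sub>R axis i 1)) has_real_derivative h' x) (at 0)"
  shows "integral (cbox 0 1) h' = 0"
proof -
  let ?e = "axis i 1 :: real^'d"
  let ?H = "\<lambda>t. integral (cbox 0 1) (\<lambda>x. h (x + t *\<^sub>R ?e))"
  have d': "((\<lambda>t. h (x + t *\<^sub>R ?e)) has_real_derivative h' (x + s *\<^sub>R ?e)) (at s within S)" for x s S
  proof -
    have "((\<lambda>t. h ((x + s *\<^sub>R ?e) + (t - s) *\<^sub>R ?e)) has_real_derivative h' (x + s *\<^sub>R ?e)) (at s)"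
      using DERIV_shift[of "\<lambda>t. h ((x + s *\<^sub>R ?e) + (t - s) *\<^sub>R ?e)" _ 0 s] d[of "x + s *\<^sub>R ?e"]
      by simp
    then show ?thesis
      by (auto simp: algebra_simps intro: has_field_derivative_at_within)
  qed
  \<comment> \<open>Invariance is known for shifts in [0, 1], so the derivative at 0 is one-sided;
    it is nevertheless unique.\<close>
  have "(?H has_real_derivative integral (cbox 0 1) (\<lambda>x. h' (x + 0 *\<^sub>R ?e))) (at 0 within cbox 0 1)"
  proof (rule leibniz_rule_field_derivative)
    show "(\<lambda>x. h (x + t *\<^sub>R ?e)) integrable_on cbox 0 1" for t
      by (intro integrable_continuous continuous_on_compose2[OF h(1)] continuous_intros) auto
    show "continuous_on (cbox 0 1 \<times> cbox 0 1) (\<lambda>(t, x). h' (x + t *\<^sub>R ?e))"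
      unfolding split_beta
      by (intro continuous_on_compose2[OF h'] continuous_intros) auto
  qed (use d' in auto)
  moreover have "(?H has_real_derivative 0) (at 0 within cbox 0 1)"
  proof (rule has_field_derivative_transform_within[where d = 1 and f = "\<lambda>_. integral (cbox 0 1) h"])
    show "integral (cbox 0 1) h = ?H t" if "t \<in> cbox 0 1" for t
      using that torus_integral_translate[OF h, of t i] by simp
  qed auto
  ultimately show ?thesis
    using vector_derivative_unique_within_closed_interval[of 0 1 0 ?H "integral (cbox 0 1) h'" 0]
    by (simp add: has_real_derivative_iff_has_vector_derivative)
qed

lemma integrable_torus:
  fixes f :: "real^'d \<Rightarrow> 'b::euclidean_space"
  assumes "continuous_on UNIV f"
  shows "integrable torus f"
  unfolding torus_def
  by (intro continuous_imp_integrable continuous_on_subset[OF assms]) auto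

lemma integral_torus:
  fixes f :: "real^'d \<Rightarrow> 'b::euclidean_space"
  assumes "continuous_on UNIV f"
  shows "(LINT x|torus. f x) = integral (cbox 0 1) f"
  using integrable_torus[OF assms] unfolding torus_def
  by (rule lebesgue_integral_eq_integral) auto

lemma measure_torus [simp]:
  "measure torus (space torus) = 1" "emeasure torus (space torus) = 1"
proof -
  have "emeasure lborel (cbox 0 (1::real^'d)) = 1"
    by (subst emeasure_lborel_cbox) (auto intro!: prod.neutral simp: Basis_vec_def inner_axis)
  then show "emeasure torus (space torus) = 1"
    by (simp add: torus_def space_restrict_space emeasure_restrict_space)
  then show "measure torus (space torus) = 1"
    by (simp add: measure_def)
qed

lemma L2_inner_eq:
  assumes "continuous_on UNIV g" "continuous_on UNIV h"
  shows "L2_inner g h = integral (cbox 0 1) (\<lambda>x. g x * h x)"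
  unfolding L2_inner_def by (intro integral_torus continuous_intros assms)

lemma L2_inner_continuous_add:
  assumes "continuous_on UNIV f" "continuous_on UNIV g" "continuous_on UNIV h"
  shows "L2_inner f (\<lambda>x. g x + h x) = L2_inner f g + L2_inner f h"
proof -
  have "integrable torus (\<lambda>x. f x * g x)" "integrable torus (\<lambda>x. f x * h x)"
    by (intro integrable_torus continuous_intros assms)+
  then show ?thesis
    unfolding L2_inner_def by (simp add: distrib_left)
qed

lemma L2_inner_mult_right [simp]: "L2_inner f (\<lambda>x. c * g x) = c * L2_inner f g"
  unfolding L2_inner_def by (simp flip: integral_mult_right_zero add: mult_ac)

lemma L2_inner_mult_left [simp]: "L2_inner (\<lambda>x. c * g x) f = c * L2_inner g f"
  unfolding L2_inner_def by (simp flip: integral_mult_right_zero add: mult_ac)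

lemma L2_inner_commute: "L2_inner f g = L2_inner g f"
  unfolding L2_inner_def by (simp add: mult.commute)

section \<open>Trigonometric functions\<close>

text \<open>Cosine and sine are kept together so that the family is closed under differentiation.
  The frequencies \<open>k\<close> and \<open>- k\<close> span the same functions, which is why
  later formulas contain both.\<close>

definition trig :: "int^'d \<Rightarrow> real \<Rightarrow> real \<Rightarrow> real^'d \<Rightarrow> real" where
  "trig k a b x = a * cos (2 * pi * (freq k \<bullet> x)) + b * sin (2 * pi * (freq k \<bullet> x))"

lemma freq_add: "freq (k + l) = freq k + freq l"
  by (simp add: freq_def vec_eq_iff)

lemma freq_diff: "freq (k - l) = freq k - freq l"
  by (simp add: freq_def vec_eq_iff)

lemma freq_minus: "freq (- k) = - freq k"
  by (simp add: freq_def vec_eq_iff)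

lemma freq_nth [simp]: "freq k $ i = of_int (k $ i)"
  by (simp add: freq_def)

lemma trig_has_derivative:
  "((\<lambda>h. trig k a b (x + h *\<^sub>R axis i 1)) has_real_derivative
     trig k (2 * pi * of_int (k $ i) * b) (- (2 * pi * of_int (k $ i) * a)) (x + s *\<^sub>R axis i 1)) (at s)"
  unfolding trig_def
  by (auto intro!: derivative_eq_intros simp: inner_add_right inner_axis algebra_simps)

lemma partial_trig:
  "partial i (trig k a b) = trig k (2 * pi * of_int (k $ i) * b) (- (2 * pi * of_int (k $ i) * a))"
proof
  fix x
  show "partial i (trig k a b) x =
      trig k (2 * pi * of_int (k $ i) * b) (- (2 * pi * of_int (k $ i) * a)) x"
    using DERIV_imp_deriv[OF trig_has_derivative[of k a b x i 0]] by (simp add: partial_def)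
qed

lemma partials_trig: "\<exists>a' b'. partials ds (trig k a b) = trig k a' b'"
proof (induction ds)
  case Nil
  show ?case by auto
next
  case (Cons i ds)
  then obtain a' b' where "partials ds (trig k a b) = trig k a' b'" by blast
  then have "partials (i # ds) (trig k a b) =
      trig k (2 * pi * of_int (k $ i) * b') (- (2 * pi * of_int (k $ i) * a'))"
    by (simp add: partial_trig)
  then show ?case by blast
qed

lemma continuous_on_trig [continuous_intros]: "continuous_on S (trig k a b)"
  unfolding trig_def by (intro continuous_intros)

lemma torus_periodic_trig: "torus_periodic (trig k a b)"
proof -
  have "2 * pi * (freq k \<bullet> (x + axis i 1)) = 2 * pi * (freq k \<bullet> x) + 2 * pi * of_int (k $ i)" for x i
    by (simp add: inner_add_right inner_axis algebra_simps)
  then show ?thesis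
    by (simp add: torus_periodic_def trig_def cos_add sin_add)
qed

lemma Ck_trig: "Ck m (trig k a b)"
  unfolding Ck_def field_differentiable_def
  by (metis continuous_on_trig partials_trig trig_has_derivative)

lemma test_fun_trig: "test_fun (trig k a b)"
  by (simp add: test_fun_def torus_periodic_trig Ck_trig)

lemma trig_mult:
  "trig k a b x * trig l c d x =
    trig (k + l) ((a * c - b * d) / 2) ((a * d + b * c) / 2) x +
    trig (k - l) ((a * c + b * d) / 2) ((b * c - a * d) / 2) x"
  by (simp add: trig_def freq_add freq_diff inner_add_left inner_diff_left
      distrib_left right_diff_distrib cos_add cos_diff sin_add sin_diff) (simp add: field_simps)

lemma integral_trig:
  fixes k :: "int^'d"
  shows "integral (cbox 0 1) (trig k a b) = (if k = 0 then a else 0)"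
proof (cases "k = 0")
  case True
  then have "trig k a b = (\<lambda>_. a)" by (auto simp: trig_def freq_def zero_vec_def inner_vec_def)
  moreover have "measure lborel (cbox 0 (1::real^'d)) = 1"
    using measure_torus(1) by (simp add: torus_def space_restrict_space measure_restrict_space)
  ultimately show ?thesis using True by (simp add: integral_const)
next
  case False
  then obtain i where i: "k $ i \<noteq> 0" by (auto simp: vec_eq_iff)
  let ?m = "2 * pi * of_int (k $ i) :: real"
  \<comment> \<open>Dividing by \<open>?m\<close> gives a periodic antiderivative in a direction in
    which \<open>k\<close> does not vanish.\<close>
  have "integral (cbox 0 1) (trig k a b) = 0"
    using trig_has_derivative[of k "- b / ?m" "a / ?m" _ i 0] i
    by (intro torus_integral_derivative[of "trig k (- b / ?m) (a / ?m)" _ i]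
        continuous_on_trig torus_periodic_trig) simp
  with False show ?thesis by simp
qed

text \<open>The sum and the difference of the frequencies contribute separately, each when it
  vanishes. Both do at \<open>k = l = 0\<close>, where the two terms add up to
  \<open>a * c\<close>.\<close>

lemma L2_inner_trig:
  "L2_inner (trig k a b) (trig l c d) =
    (if k + l = 0 then (a * c - b * d) / 2 else 0) + (if k = l then (a * c + b * d) / 2 else 0)"
  by (subst L2_inner_eq) (auto simp: trig_mult integral_trig integral_add
      integrable_continuous continuous_on_trig)

section \<open>Linear operations on test functions, and cosines as distributions\<close>

lemma Ck_partials_add:
  assumes "Ck m f" "Ck m g" "length ds \<le> m"
  shows "partials ds (\<lambda>x. f x + g x) = (\<lambda>x. partials ds f x + partials ds g x)"
  using assms(3)
proof (induction ds)
  case (Cons i ds)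
  have "((\<lambda>h. partials ds h' (x + h *\<^sub>R axis i 1)) has_real_derivative partials (i # ds) h' x) (at 0)"
    if "Ck m h'" for h' x
    using that Cons.prems by (auto simp: Ck_def partial_def DERIV_deriv_iff_field_differentiable)
  from DERIV_add[OF this[OF assms(1)] this[OF assms(2)]] Cons show ?case
    by (auto simp: partial_def fun_eq_iff dest!: DERIV_imp_deriv)
qed simp

lemma Ck_partials_cmult:
  assumes "Ck m f" "length ds \<le> m"
  shows "partials ds (\<lambda>x. c * f x) = (\<lambda>x. c * partials ds f x)"
  using assms(2)
proof (induction ds)
  case (Cons i ds)
  have "((\<lambda>h. partials ds f (x + h *\<^sub>R axis i 1)) has_real_derivative partials (i # ds) f x) (at 0)" for x
    using assms Cons.prems by (auto simp: Ck_def partial_def DERIV_deriv_iff_field_differentiable)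
  from DERIV_cmult[OF this] Cons show ?case
    by (auto simp: partial_def fun_eq_iff dest!: DERIV_imp_deriv)
qed simp

lemma Ck_add:
  assumes "Ck m f" "Ck m g"
  shows "Ck m (\<lambda>x. f x + g x)"
  using assms Ck_partials_add[OF assms]
  by (simp add: Ck_def continuous_on_add field_differentiable_add)

lemma Ck_cmult:
  assumes "Ck m f"
  shows "Ck m (\<lambda>x. c * f x)"
  using assms Ck_partials_cmult[OF assms]
  by (simp add: Ck_def continuous_on_mult field_differentiable_mult)

lemma test_fun_add: "test_fun f \<Longrightarrow> test_fun g \<Longrightarrow> test_fun (\<lambda>x. f x + g x)"
  by (simp add: test_fun_def torus_periodic_def Ck_add)

lemma test_fun_cmult: "test_fun f \<Longrightarrow> test_fun (\<lambda>x. c * f x)"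
  by (simp add: test_fun_def torus_periodic_def Ck_cmult)

lemma Ck_continuous: "Ck m f \<Longrightarrow> continuous_on UNIV f"
  unfolding Ck_def by (metis list.size(3) partials.simps(1) zero_le)

lemma test_fun_continuous: "test_fun f \<Longrightarrow> continuous_on UNIV f"
  by (auto simp: test_fun_def Ck_continuous)

definition trig_dist :: "int^'d::finite \<Rightarrow> real \<Rightarrow> 'd distribution" where
  "trig_dist k a \<phi> = (if test_fun \<phi> then L2_inner (trig k a 0) \<phi> else 0)"

lemma space_torus [simp]: "space torus = cbox 0 1"
  by (simp add: torus_def space_restrict_space)

lemma L2_inner_bound:
  fixes f g :: "real^'d \<Rightarrow> real"
  assumes "continuous_on UNIV f" "continuous_on UNIV g"
    and "\<And>x. x \<in> cbox 0 1 \<Longrightarrow> \<bar>f x\<bar> \<le> c" "\<And>x. x \<in> cbox 0 1 \<Longrightarrow> \<bar>g x\<bar> \<le> d"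
  shows "\<bar>L2_inner f g\<bar> \<le> c * d"
proof -
  have cd: "\<bar>f x * g x\<bar> \<le> c * d" if "x \<in> cbox 0 1" for x
    using assms(3)[OF that] assms(4)[OF that] by (simp add: abs_mult mult_mono)
  have i: "integrable torus (\<lambda>x. f x * g x)"
    by (intro integrable_torus continuous_intros assms)
  have j: "integrable torus (\<lambda>x::real^'d. c * d)"
    by (intro integrable_torus continuous_intros)
  have "(LINT x|torus. \<bar>f x * g x\<bar>) \<le> (LINT x|(torus :: (real^'d) measure). c * d)"
    by (intro integral_mono cd integrable_abs i j) simp
  then have "(LINT x|torus. \<bar>f x * g x\<bar>) \<le> c * d"
    using measure_torus(1) by (simp del: space_torus)
  then show ?thesis
    unfolding L2_inner_def by (rule order_trans[OF integral_abs_bound])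
qed

lemma trig_bound: "\<bar>trig k a 0 x\<bar> \<le> \<bar>a\<bar>"
  by (simp add: trig_def abs_mult mult_left_le)

lemma trig_dist_distribution: "trig_dist k a \<in> distributions"
proof -
  have "\<bar>trig_dist k a \<phi>\<bar> \<le> \<bar>a\<bar> * M"
    if "test_fun \<phi>" "\<And>ds x. length ds \<le> 0 \<Longrightarrow> \<bar>partials ds \<phi> x\<bar> \<le> M" for \<phi> M
    using that that(2)[of "[]"]
    by (auto simp: trig_dist_def intro!: L2_inner_bound continuous_on_trig test_fun_continuous trig_bound)
  then have "\<exists>m C. \<forall>\<phi> M. test_fun \<phi> \<and> (\<forall>ds x. length ds \<le> m \<longrightarrow> \<bar>partials ds \<phi> x\<bar> \<le> M)
        \<longrightarrow> \<bar>trig_dist k a \<phi>\<bar> \<le> C * M"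
    by blast
  then show ?thesis
    unfolding distributions_def
    by (auto simp: trig_dist_def test_fun_add test_fun_cmult L2_inner_continuous_add
        test_fun_continuous continuous_on_trig)
qed

lemma fourier_coeff_trig:
  "fourier_coeff u k = Complex (u (trig k 1 0)) (- u (trig k 0 1))"
proof -
  have "trig k 1 0 = (\<lambda>x. cos (2 * pi * (freq k \<bullet> x)))" "trig k 0 1 = (\<lambda>x. sin (2 * pi * (freq k \<bullet> x)))"
    by (auto simp: trig_def)
  then show ?thesis by (simp add: fourier_coeff_def)
qed

text \<open>A cosine is half the sum of two exponentials. Adding two conditionals also gives the
  right value \<open>a\<close> at \<open>k = 0\<close>, where the two frequencies coincide.\<close>

lemma fourier_coeff_trig_dist:
  "fourier_coeff (trig_dist k a) l =
    of_real ((if l = - k then a / 2 else 0) + (if l = k then a / 2 else 0))"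
  by (auto simp: fourier_coeff_trig trig_dist_def test_fun_trig L2_inner_trig complex_eq_iff
      eq_neg_iff_add_eq_0 add.commute)

section \<open>Littlewood-Paley blocks and L^p norms of a single mode\<close>

lemma finite_bounded_freq: "finite {k :: int^'d. norm (freq k) \<le> r}"
proof (rule finite_subset)
  let ?S = "{- \<lfloor>r\<rfloor>..\<lfloor>r\<rfloor>}"
  show "{k :: int^'d. norm (freq k) \<le> r} \<subseteq> vec_lambda ` (PiE UNIV (\<lambda>_. ?S))"
  proof
    fix k :: "int^'d" assume "k \<in> {k. norm (freq k) \<le> r}"
    then have "\<bar>of_int (k $ i)\<bar> \<le> r" for i
      using component_le_norm_cart[of "freq k" i] by simp
    then have "\<bar>k $ i\<bar> \<le> \<lfloor>r\<rfloor>" for i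
      by (simp add: le_floor_iff)
    then have "vec_nth k \<in> PiE UNIV (\<lambda>_. ?S)"
      by (auto simp: PiE_def Pi_def abs_le_iff) (metis abs_le_D2 minus_le_iff)
    then show "k \<in> vec_lambda ` (PiE UNIV (\<lambda>_. ?S))"
      by (metis image_eqI vec_nth_inverse)
  qed
qed (intro finite_imageI finite_PiE; simp)

text \<open>A sum over an infinite set is 0 in HOL; finiteness makes \<open>lp_block\<close> the
  intended trigonometric sum.\<close>

lemma finite_dyadic:
  fixes \<eta> :: "real^'d \<Rightarrow> real"
  assumes "lp_cutoff \<eta>"
  shows "finite {k. dyadic \<eta> j (freq k) \<noteq> 0}"
proof (rule finite_subset[OF _ finite_bounded_freq])
  show "{k. dyadic \<eta> j (freq k) \<noteq> 0} \<subseteq> {k. norm (freq k) \<le> 2 * 2 ^ j}"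
  proof (safe, rule ccontr)
    fix k assume k: "dyadic \<eta> j (freq k) \<noteq> 0" "\<not> norm (freq k) \<le> 2 * 2 ^ j"
    have "\<eta> (freq k /\<^sub>R 2 ^ i) = 0" if "i \<le> j" for i
    proof -
      have "2 * 2 ^ i \<le> (2 * 2 ^ j :: real)" using that by (simp add: power_increasing)
      with k(2) have "2 * 2 ^ i \<le> norm (freq k)" by linarith
      then show ?thesis using assms by (auto simp: lp_cutoff_def field_simps)
    qed
    then have "\<eta> (freq k /\<^sub>R 2 ^ i) = 0" if "i \<le> j" for i using that by blast
    from this[of 0] this[of j] this[of "j - 1"] k(1) show False
      by (cases j) auto
  qed
qed

text \<open>At frequencies of modulus \<open>2 ^ n\<close> only the \<open>n\<close>-th dyadic piece survives: the cutoff is 1 at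
  modulus 1 and 0 at modulus 2.\<close>

lemma dyadic_at_power:
  assumes "lp_cutoff \<eta>" "norm x = 2 ^ n"
  shows "dyadic \<eta> j x = (if j = n then 1 else 0)"
proof -
  have one: "\<eta> (x /\<^sub>R 2 ^ i) = 1" if "n \<le> i" for i
    using assms that by (auto simp: lp_cutoff_def field_simps power_increasing)
  have zero: "\<eta> (x /\<^sub>R 2 ^ i) = 0" if "i < n" for i
  proof -
    have "(2::real) ^ Suc i \<le> 2 ^ n" using that by (intro power_increasing) auto
    then show ?thesis using assms by (auto simp: lp_cutoff_def field_simps)
  qed
  show ?thesis
  proof (cases j)
    case 0
    then show ?thesis using one[of 0] zero[of 0] by auto
  next
    case (Suc i)
    then show ?thesis
      using one[of i] one[of j] zero[of i] zero[of j] by (cases "n \<le> i"; cases "n = j") auto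
  qed
qed

lemma lp_block_trig_dist:
  fixes \<eta> :: "real^'d \<Rightarrow> real"
  assumes "lp_cutoff \<eta>" "norm (freq k) = 2 ^ n"
  shows "lp_block \<eta> j (trig_dist k a) = (if j = n then \<lambda>x. of_real (trig k a 0 x) else (\<lambda>x. 0))"
proof
  fix x
  let ?S = "{l. dyadic \<eta> j (freq l) \<noteq> 0}"
  let ?g = "\<lambda>l. of_real (dyadic \<eta> j (freq l)) * fourier_coeff (trig_dist k a) l *
    cis (2 * pi * (freq l \<bullet> x))"
  \<comment> \<open>The frequencies \<open>k\<close> and \<open>- k\<close> must differ, so that the
    pair contributes two summands with coefficient \<open>a / 2\<close>.\<close>
  have "freq k \<noteq> 0" using assms(2) by auto
  then have k: "k \<noteq> - k" by (auto simp: freq_def vec_eq_iff)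
  have d: "dyadic \<eta> j (freq k) = (if j = n then 1 else 0)" "dyadic \<eta> j (freq (- k)) = (if j = n then 1 else 0)"
    by (rule dyadic_at_power; use assms in \<open>simp add: freq_minus\<close>)+
  have "lp_block \<eta> j (trig_dist k a) x = sum ?g (?S \<inter> {k, - k})"
    unfolding lp_block_def
    by (rule sum.mono_neutral_right) (auto simp: finite_dyadic assms fourier_coeff_trig_dist)
  also have "\<dots> = (if j = n then of_real (trig k a 0 x) else 0)"
  proof (cases "j = n")
    case True
    then have "?S \<inter> {k, - k} = {k, - k}" using d by auto
    then show ?thesis
      using True k d by (auto simp: fourier_coeff_trig_dist trig_def freq_minus complex_eq_iff)
  next
    case False
    then have "?S \<inter> {k, - k} = {}" using d by auto
    then show ?thesis using False by (simp only: sum.empty if_False)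
  qed
  finally show "lp_block \<eta> j (trig_dist k a) x =
      (if j = n then \<lambda>x. of_real (trig k a 0 x) else (\<lambda>x. 0)) x" by simp
qed

lemma Lp_norm_nonneg [simp]: "0 \<le> Lp_norm p g"
  by (simp add: Lp_norm_def)

text \<open>The p-th moment of a cosine is compared with its mean square 1/2: the modulus is at most
  1 and p \<le> 2, so the p-th power dominates the square. The root 1/p \<le> 1 can only enlarge
  1/2, hence one factor 1/2 serves all p.\<close>

lemma Lp_norm_trig:
  fixes k :: "int^'d"
  assumes p: "1 \<le> p" "p \<le> 2" and k: "k \<noteq> 0"
  shows "Lp_norm p (\<lambda>x. complex_of_real (trig k a 0 x)) \<le> \<bar>a\<bar>"
    and "\<bar>a\<bar> / 2 \<le> Lp_norm p (\<lambda>x. complex_of_real (trig k a 0 x))"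
proof -
  let ?c = "\<lambda>x. trig k 1 0 x"
  have c1: "\<bar>?c x\<bar> \<le> 1" for x using trig_bound[of k 1 x] by simp
  have int: "integrable torus (\<lambda>x. \<bar>?c x\<bar> powr p)"
    using p by (intro integrable_torus continuous_on_powr' continuous_intros) auto
  have int2: "integrable torus (\<lambda>x. (?c x)\<^sup>2)"
    by (intro integrable_torus continuous_intros)
  have int1: "integrable torus (\<lambda>x::real^'d. 1::real)"
    by (intro integrable_torus continuous_intros)
  let ?I = "LINT x|torus. \<bar>?c x\<bar> powr p"
  have up: "?I \<le> 1"
  proof -
    have "?I \<le> (LINT x|(torus :: (real^'d) measure). 1)"
      using p c1 by (intro integral_mono int int1) (auto intro: powr_le1)
    then show ?thesis using measure_torus(1) by (simp del: space_torus)
  qed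
  have lo: "1 / 2 \<le> ?I"
  proof -
    have "(?c x)\<^sup>2 \<le> \<bar>?c x\<bar> powr p" for x
    proof (cases "?c x = 0")
      case False
      have "(?c x)\<^sup>2 = \<bar>?c x\<bar> powr 2" using False by (simp add: powr_numeral)
      also have "\<dots> \<le> \<bar>?c x\<bar> powr p" using p c1[of x] False by (intro powr_mono') auto
      finally show ?thesis .
    qed simp
    then have "(LINT x|torus. (?c x)\<^sup>2) \<le> ?I"
      by (intro integral_mono int int2)
    moreover have "(LINT x|torus. (?c x)\<^sup>2) = 1 / 2"
    proof -
      have "k + k \<noteq> 0" using k by (auto simp: vec_eq_iff)
      then show ?thesis
        using L2_inner_trig[of k 1 0 k 1 0] by (simp add: L2_inner_def power2_eq_square)
    qed
    ultimately show ?thesis by simp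
  qed
  have eq: "Lp_norm p (\<lambda>x. complex_of_real (trig k a 0 x)) = \<bar>a\<bar> * ?I powr (1 / p)"
  proof -
    have "trig k a 0 x = a * ?c x" for x by (simp add: trig_def)
    then have "norm (complex_of_real (trig k a 0 x)) powr p = \<bar>a\<bar> powr p * \<bar>?c x\<bar> powr p" for x
      by (simp add: norm_mult powr_mult)
    then have "Lp_norm p (\<lambda>x. complex_of_real (trig k a 0 x)) = (\<bar>a\<bar> powr p * ?I) powr (1 / p)"
      unfolding Lp_norm_def by simp
    also have "\<dots> = \<bar>a\<bar> * ?I powr (1 / p)"
      using p by (subst powr_mult) (auto simp: powr_powr)
    finally show ?thesis .
  qed
  have "?I powr (1 / p) \<le> 1" using up p by (intro powr_le1) auto
  then show "Lp_norm p (\<lambda>x. complex_of_real (trig k a 0 x)) \<le> \<bar>a\<bar>"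
    unfolding eq by (simp add: mult_left_le)
  have "(1 / 2) powr 1 \<le> (1 / 2 :: real) powr (1 / p)" using p by (intro powr_mono') auto
  also have "\<dots> \<le> ?I powr (1 / p)" using lo p by (intro powr_mono2) auto
  finally have "1 / 2 \<le> ?I powr (1 / p)" by simp
  from mult_left_mono[OF this abs_ge_zero[of a]]
  show "\<bar>a\<bar> / 2 \<le> Lp_norm p (\<lambda>x. complex_of_real (trig k a 0 x))"
    unfolding eq by simp
qed

section \<open>Completeness of the trigonometric system\<close>

inductive trig_poly :: "(real^'d \<Rightarrow> real) \<Rightarrow> bool" where
  trig_poly_trig: "trig_poly (trig k a b)"
| trig_poly_add: "trig_poly f \<Longrightarrow> trig_poly g \<Longrightarrow> trig_poly (\<lambda>x. f x + g x)"

lemma trig_poly_mult: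
  assumes "trig_poly f" "trig_poly g"
  shows "trig_poly (\<lambda>x. f x * g x)"
  using assms
proof (induction f)
  case (trig_poly_trig k a b)
  then show ?case
    by (induction g) (simp_all add: trig_mult distrib_left trig_poly.intros)
next
  case (trig_poly_add f1 f2)
  then show ?case by (simp add: distrib_right trig_poly.trig_poly_add)
qed

lemma trig_poly_continuous: "trig_poly f \<Longrightarrow> continuous_on UNIV f"
  by (induction f rule: trig_poly.induct) (auto intro!: continuous_intros)

lemma trig_poly_orthogonal:
  assumes "trig_poly g" "continuous_on UNIV w" "\<And>k a b. L2_inner w (trig k a b) = 0"
  shows "L2_inner w g = 0"
  using assms(1)
  by (induction g) (simp_all add: assms L2_inner_continuous_add trig_poly_continuous)

lemma torus_periodic_int:
  assumes "torus_periodic w"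
  shows "w (x + freq m) = w x"
proof -
  have step: "w (x + axis i 1) = w x" for x i
    using assms by (simp add: torus_periodic_def)
  have nat: "w (x + real n *\<^sub>R axis i 1) = w x" for x i n
  proof (induction n)
    case (Suc n)
    have "w (x + real (Suc n) *\<^sub>R axis i 1) = w ((x + real n *\<^sub>R axis i 1) + axis i 1)"
      by (simp add: algebra_simps)
    with Suc step show ?case by simp
  qed simp
  have int: "w (x + of_int n *\<^sub>R axis i 1) = w x" for x i n
  proof (cases "n \<ge> 0")
    case True
    then show ?thesis using nat[of x "nat n" i] by simp
  next
    case False
    then show ?thesis using nat[of "x + of_int n *\<^sub>R axis i 1" "nat (- n)" i] by simp
  qed
  have "w (x + (\<Sum>i\<in>A. of_int (m $ i) *\<^sub>R axis i 1)) = w x" if "finite A" for A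
    using that
  proof induction
    case (insert j A)
    have "w (x + (\<Sum>i\<in>insert j A. of_int (m $ i) *\<^sub>R axis i 1)) =
        w ((x + (\<Sum>i\<in>A. of_int (m $ i) *\<^sub>R axis i 1)) + of_int (m $ j) *\<^sub>R axis j 1)"
      using insert by (simp add: add_ac)
    with insert int show ?case by simp
  qed simp
  moreover have "(\<Sum>i\<in>UNIV. of_int (m $ i) *\<^sub>R axis i 1) = freq m"
    by (simp add: vec_eq_iff axis_def if_distrib[of "(*) _"] sum.delta cong: if_cong)
  ultimately show ?thesis by (metis finite)
qed

text \<open>The map \<open>E\<close> identifies the torus with a compact subset of a complex vector space, on which
  trigonometric polynomials separate points, so that Stone-Weierstrass applies.\<close>

lemma torus_fourier_complete:
  fixes w :: "real^'d \<Rightarrow> real"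
  assumes w: "continuous_on UNIV w" "torus_periodic w"
    and orth: "\<And>k a b. L2_inner w (trig k a b) = 0"
  shows "L2_inner w w = 0"
proof -
  define E :: "real^'d \<Rightarrow> complex^'d" where "E x = (\<chi> i. cis (2 * pi * x $ i))" for x
  define S where "S = E ` cbox 0 1"
  \<comment> \<open>\<open>W\<close> is \<open>w\<close> transported to the image of the cube.
    Opposite faces are glued there; by periodicity the value does not depend on the chosen
    preimage.\<close>
  define W where "W z = w (SOME x. x \<in> cbox 0 1 \<and> E x = z)" for z
  have contE: "continuous_on A E" for A
    unfolding E_def by (intro continuous_intros)
  have w_eq: "w x = w y" if "E x = E y" for x y
  proof -
    have "\<exists>n. x $ i = y $ i + of_int n" for i
    proof -
      have "cis (2 * pi * x $ i) = cis (2 * pi * y $ i)"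
        using that by (simp add: E_def vec_eq_iff)
      then have "sin (2 * pi * x $ i) = sin (2 * pi * y $ i) \<and> cos (2 * pi * x $ i) = cos (2 * pi * y $ i)"
        by (simp add: complex_eq_iff)
      then obtain n :: int where "2 * pi * x $ i = 2 * pi * y $ i + 2 * pi * n"
        using sin_cos_eq_iff by blast
      then have "2 * pi * x $ i = 2 * pi * (y $ i + n)" by (simp add: algebra_simps)
      then show ?thesis by auto
    qed
    then obtain n where "x $ i = y $ i + of_int (n i)" for i by metis
    then have "x = y + freq (\<chi> i. n i)" by (simp add: vec_eq_iff)
    then show ?thesis using torus_periodic_int[OF w(2)] by simp
  qed
  have W: "W (E x) = w x" if "x \<in> cbox 0 1" for x
  proof -
    have "\<exists>y. y \<in> cbox 0 1 \<and> E y = E x" using that by blast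
    from someI_ex[OF this] show ?thesis unfolding W_def by (intro w_eq) blast
  qed
  have compS: "compact S"
    unfolding S_def by (intro compact_continuous_image contE) simp
  \<comment> \<open>The chosen preimage need not depend continuously on \<open>z\<close>. Continuity
    is read off from closed sets instead: \<open>E\<close> maps compact subsets of the cube onto
    closed sets.\<close>
  have contW: "continuous_on S W"
    unfolding continuous_on_closed_invariant
  proof (intro allI impI)
    fix B :: "real set" assume "closed B"
    then have "closed (w -` B)" using w(1) by (simp add: continuous_on_closed_vimage)
    then have "compact (cbox 0 1 \<inter> w -` B)" by (intro compact_Int_closed) auto
    then have "closed (E ` (cbox 0 1 \<inter> w -` B))"
      by (intro compact_imp_closed compact_continuous_image contE)
    moreover have "E ` (cbox 0 1 \<inter> w -` B) \<inter> S = W -` B \<inter> S"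
      by (auto simp: S_def W) (metis w_eq)
    ultimately show "\<exists>A. closed A \<and> A \<inter> S = W -` B \<inter> S" by blast
  qed
  have approx: "\<exists>g. trig_poly g \<and> (\<forall>x\<in>cbox 0 1. \<bar>w x - g x\<bar> < e)" if "e > 0" for e
  proof -
    have "\<exists>G. (continuous_on S G \<and> trig_poly (\<lambda>x. G (E x))) \<and> (\<forall>z\<in>S. \<bar>W z - G z\<bar> < e)"
    proof (rule Stone_Weierstrass_HOL[OF compS])
      fix c :: real
      have "trig 0 c 0 = (\<lambda>x::real^'d. c)"
        by (auto simp: trig_def freq_def zero_vec_def inner_vec_def)
      then show "continuous_on S (\<lambda>x. c) \<and> trig_poly (\<lambda>x::real^'d. c)"
        using trig_poly_trig[of "0 :: int^'d" c 0] by simp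
    next
      fix z z' assume "z \<in> S \<and> z' \<in> S \<and> z \<noteq> z'"
      then obtain i where i: "z $ i \<noteq> z' $ i" by (auto simp: vec_eq_iff)
      have fr: "freq (axis i 1) \<bullet> x = x $ i" for x :: "real^'d"
        by (simp add: inner_vec_def axis_def if_distrib[of real_of_int]
            if_distribR if_distrib[of "\<lambda>y. y * _"] cong: if_cong)
      \<comment> \<open>Real and imaginary parts of the coordinates are trigonometric functions of
        unit frequency, and they separate points.\<close>
      have "trig (axis i 1) 1 0 = (\<lambda>x::real^'d. Re (E x $ i))" "trig (axis i 1) 0 1 = (\<lambda>x::real^'d. Im (E x $ i))"
        by (auto simp: trig_def fr E_def)
      then have P: "trig_poly (\<lambda>x. Re (E x $ i))" "trig_poly (\<lambda>x. Im (E x $ i))"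
        using trig_poly_trig[of "axis i 1 :: int^'d"] by metis+
      have C: "continuous_on S (\<lambda>z. Re (z $ i))" "continuous_on S (\<lambda>z. Im (z $ i))"
        by (intro continuous_intros)+
      show "\<exists>f. (continuous_on S f \<and> trig_poly (\<lambda>x. f (E x))) \<and> f z \<noteq> f z'"
        using i P C by (auto simp: complex_eq_iff)
    qed (use that contW trig_poly_mult in \<open>auto intro: continuous_intros trig_poly_add\<close>)
    then show ?thesis by (force simp: S_def W)
  qed
  have "bounded (w ` cbox 0 1)"
    by (intro compact_imp_bounded compact_continuous_image continuous_on_subset[OF w(1)]) auto
  then obtain M where M: "M > 0" "\<And>x. x \<in> cbox 0 1 \<Longrightarrow> \<bar>w x\<bar> \<le> M"
    by (auto simp: bounded_pos)
  have "\<bar>L2_inner w w\<bar> \<le> e" if "e > 0" for e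
  proof -
    from that M have "e / M > 0" by simp
    from approx[OF this] obtain g
      where g: "trig_poly g" "\<And>x. x \<in> cbox 0 1 \<Longrightarrow> \<bar>w x - g x\<bar> < e / M" by blast
    have c1: "continuous_on UNIV g" by (rule trig_poly_continuous[OF g(1)])
    have c2: "continuous_on UNIV (\<lambda>x. w x - g x)" by (intro continuous_intros w(1) c1)
    \<comment> \<open>The approximant is orthogonal to \<open>w\<close>, so only the error remains,
      and it contributes at most \<open>M * (e / M)\<close>.\<close>
    have "L2_inner w w = L2_inner w (\<lambda>x. g x + (w x - g x))" by simp
    also have "\<dots> = L2_inner w g + L2_inner w (\<lambda>x. w x - g x)"
      by (intro L2_inner_continuous_add w(1) c1 c2)
    also have "L2_inner w g = 0"
      by (rule trig_poly_orthogonal[OF g(1) w(1) orth])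
    finally have "\<bar>L2_inner w w\<bar> \<le> M * (e / M)"
      using L2_inner_bound[OF w(1) c2 M(2) less_imp_le[OF g(2)]] by simp
    with M show ?thesis by simp
  qed
  then have "\<bar>L2_inner w w\<bar> \<le> 0" by (rule field_le_epsilon) simp
  then show ?thesis by simp
qed

section \<open>Uniqueness for the heat equation\<close>

text \<open>The eigenvalue of the negative Laplacian on the modes of frequency
  \<open>k\<close>.\<close>

definition laplace_symbol :: "int^'d \<Rightarrow> real" where
  "laplace_symbol k = (2 * pi * norm (freq k))\<^sup>2"

lemma laplace_symbol_eq: "laplace_symbol k = (\<Sum>i\<in>UNIV. (2 * pi * of_int (k $ i))\<^sup>2)"
proof -
  have "laplace_symbol k = (2 * pi)\<^sup>2 * (norm (freq k))\<^sup>2"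
    by (simp only: laplace_symbol_def power_mult_distrib)
  also have "(norm (freq k))\<^sup>2 = (\<Sum>i\<in>UNIV. (of_int (k $ i))\<^sup>2)"
    by (simp only: power2_norm_eq_inner inner_vec_def) (simp add: power2_eq_square)
  finally show ?thesis
    by (simp add: sum_distrib_left power_mult_distrib)
qed

lemma torus_periodic_partial:
  assumes "torus_periodic g"
  shows "torus_periodic (partial i g)"
proof -
  have "g (x + axis j 1 + h *\<^sub>R axis i 1) = g (x + h *\<^sub>R axis i 1)" for x j h
  proof -
    have "g ((x + h *\<^sub>R axis i 1) + axis j 1) = g (x + h *\<^sub>R axis i 1)"
      using assms unfolding torus_periodic_def by blast
    then show ?thesis by (simp add: add_ac)
  qed
  then show ?thesis by (simp add: torus_periodic_def partial_def)
qed

text \<open>Integration by parts: integrate the \<open>i\<close>-th derivative of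
  \<open>\<partial>\<^sub>i g * \<phi> - g * \<partial>\<^sub>i \<phi>\<close>.\<close>

lemma integral_second_partial_trig:
  assumes g: "Ck 2 g" "torus_periodic g"
  shows "integral (cbox 0 1) (\<lambda>x. partials [i, i] g x * trig k a b x) =
    - (2 * pi * of_int (k $ i))\<^sup>2 * integral (cbox 0 1) (\<lambda>x. g x * trig k a b x)"
proof -
  define m :: real where "m = 2 * pi * of_int (k $ i)"
  let ?h = "\<lambda>x. partials [i] g x * trig k a b x - g x * trig k (m * b) (- (m * a)) x"
  \<comment> \<open>The products of first derivatives cancel in the derivative of \<open>?h\<close>,
    and differentiating the trigonometric factor twice gives \<open>- m\<^sup>2\<close>.\<close>
  let ?h' = "\<lambda>x. partials [i, i] g x * trig k a b x + m\<^sup>2 * (g x * trig k a b x)"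
  have cont: "continuous_on UNIV (partials ds g)" if "length ds \<le> 2" for ds
    using g(1) that by (simp add: Ck_def)
  have c: "continuous_on UNIV (partials [i, i] g)" "continuous_on UNIV g" "continuous_on UNIV (partials [i] g)"
    using cont[of "[i, i]"] cont[of "[]"] cont[of "[i]"] by auto
  have d: "((\<lambda>t. partials ds g (x + t *\<^sub>R axis i 1)) has_real_derivative partials (i # ds) g x) (at 0)"
    if "length ds < 2" for ds x
    using g(1) that by (auto simp: Ck_def partial_def DERIV_deriv_iff_field_differentiable)
  have per: "torus_periodic ?h"
    using g(2) torus_periodic_partial[OF g(2), of i] torus_periodic_trig[of k]
    by (simp add: torus_periodic_def)
  have "((\<lambda>t. ?h (x + t *\<^sub>R axis i 1)) has_real_derivative ?h' x) (at 0)" for x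
  proof -
    have "trig k (m * (- (m * a))) (- (m * (m * b))) x = - m\<^sup>2 * trig k a b x"
      by (simp add: trig_def power2_eq_square algebra_simps)
    then have d2: "((\<lambda>t. trig k (m * b) (- (m * a)) (x + t *\<^sub>R axis i 1)) has_real_derivative
        - m\<^sup>2 * trig k a b x) (at 0)"
      using trig_has_derivative[of k "m * b" "- (m * a)" x i 0] unfolding m_def[symmetric]
      by (simp del: mult_minus_right)
    have d1: "((\<lambda>t. trig k a b (x + t *\<^sub>R axis i 1)) has_real_derivative
        trig k (m * b) (- (m * a)) x) (at 0)"
      using trig_has_derivative[of k a b x i 0] unfolding m_def[symmetric] by simp
    have dg: "((\<lambda>t. partials [i] g (x + t *\<^sub>R axis i 1)) has_real_derivative partials [i, i] g x) (at 0)"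
        "((\<lambda>t. g (x + t *\<^sub>R axis i 1)) has_real_derivative partials [i] g x) (at 0)"
      using d[of "[i]" x] d[of "[]" x] by simp_all
    show ?thesis
      using DERIV_diff[OF DERIV_mult[OF dg(1) d1] DERIV_mult[OF dg(2) d2]]
      by (simp add: algebra_simps del: partials.simps)
  qed
  then have "integral (cbox 0 1) ?h' = 0"
    using per by (rule_tac torus_integral_derivative[of ?h]) (auto intro!: continuous_intros c simp del: partials.simps)
  moreover have "integral (cbox 0 1) ?h' =
      integral (cbox 0 1) (\<lambda>x. partials [i, i] g x * trig k a b x) +
      m\<^sup>2 * integral (cbox 0 1) (\<lambda>x. g x * trig k a b x)"
    by (subst integral_add)
      (auto intro!: integrable_continuous continuous_intros continuous_on_subset[OF c(1)]
        continuous_on_subset[OF c(2)] simp del: partials.simps)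
  ultimately show ?thesis by (simp add: m_def)
qed

lemma continuous_on_slice:
  assumes "continuous_on (A \<times> UNIV) (\<lambda>(t, x). u t x)" "t \<in> A"
  shows "continuous_on UNIV (u t)"
proof -
  have "continuous_on UNIV (\<lambda>x. (t, x))"
    by (intro continuous_on_Pair continuous_on_const continuous_on_id)
  from continuous_on_compose2[OF assms(1) this] assms(2) show ?thesis by auto
qed

text \<open>The coefficient M satisfies M' = - \<lambda> M, so exp(\<lambda> t) M(t) is constant.
  The equation is available for 0 < t < T only, hence both end points are reached by limits: 0
  through the distributional initial condition, T through continuity.\<close>

lemma heat_solution_coefficient:
  fixes u :: "real \<Rightarrow> real^'d \<Rightarrow> real"
  assumes T: "0 < T" and sol: "heat_solution T f u"
  shows "L2_inner (u T) (trig k a b) = exp (- laplace_symbol k * T) * f (trig k a b)"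
proof -
  let ?\<phi> = "trig k a b" and ?lam = "laplace_symbol k"
  define M where "M t = integral (cbox 0 1) (\<lambda>x. u t x * ?\<phi> x)" for t
  have per: "torus_periodic (u t)" if "t \<in> {0<..T}" for t
    using sol that by (simp add: heat_solution_def)
  have joint: "continuous_on ({0<..T} \<times> UNIV) (\<lambda>(t, x). u t x)"
    using sol by (simp add: heat_solution_def)
  have cont: "continuous_on UNIV (u t)" if "t \<in> {0<..T}" for t
    by (rule continuous_on_slice[OF joint that])
  have jointp: "continuous_on ({0<..<T} \<times> UNIV) (\<lambda>(t, x). partials ds (u t) x)" if "length ds \<le> 2" for ds
    using sol that by (simp add: heat_solution_def)
  have C2: "Ck 2 (u t)" if "t \<in> {0<..<T}" for t
    using sol that by (simp add: heat_solution_def)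
  have contM: "continuous_on {0<..T} M"
    unfolding M_def
  proof (rule integral_continuous_on_param)
    show "continuous_on ({0<..T} \<times> cbox 0 1) (\<lambda>(t, x). u t x * ?\<phi> x)"
      using continuous_on_subset[OF joint, of "{0<..T} \<times> cbox 0 1"]
      unfolding split_beta
      by (intro continuous_intros continuous_on_compose2[OF continuous_on_trig[of UNIV]]) auto
  qed
  have derM: "(M has_real_derivative - ?lam * M t) (at t within {0<..<T})" if t: "t \<in> {0<..<T}" for t
  proof -
    have "(M has_real_derivative integral (cbox 0 1) (\<lambda>x. (\<Sum>i\<in>UNIV. partials [i, i] (u t) x) * ?\<phi> x))
        (at t within {0<..<T})"
      unfolding M_def
    proof (rule leibniz_rule_field_derivative)
      fix s x assume s: "s \<in> {0<..<T}"
      then have "((\<lambda>t. u t x) has_real_derivative (\<Sum>i\<in>UNIV. partials [i, i] (u s) x)) (at s)"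
        using sol unfolding heat_solution_def by blast
      from DERIV_cmult_right[OF this, of "?\<phi> x"]
      show "((\<lambda>t. u t x * ?\<phi> x) has_real_derivative (\<Sum>i\<in>UNIV. partials [i, i] (u s) x) * ?\<phi> x)
          (at s within {0<..<T})"
        by (rule has_field_derivative_at_within)
    next
      fix s assume "s \<in> {0<..<T}"
      then show "(\<lambda>x. u s x * ?\<phi> x) integrable_on cbox 0 1"
        by (intro integrable_continuous continuous_intros continuous_on_subset[OF cont]) auto
    next
      have "continuous_on ({0<..<T} \<times> cbox 0 1) (\<lambda>z. partials [i, i] (u (fst z)) (snd z))" for i
        using continuous_on_subset[OF jointp[of "[i, i]"], of "{0<..<T} \<times> cbox 0 1"]
        by (auto simp: split_beta)
      then show "continuous_on ({0<..<T} \<times> cbox 0 1)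
          (\<lambda>(s, x). (\<Sum>i\<in>UNIV. partials [i, i] (u s) x) * ?\<phi> x)"
        unfolding split_beta
        by (intro continuous_intros continuous_on_compose2[OF continuous_on_trig[of UNIV]]) auto
    qed (use t in auto)
    also have "integral (cbox 0 1) (\<lambda>x. (\<Sum>i\<in>UNIV. partials [i, i] (u t) x) * ?\<phi> x) =
        (\<Sum>i\<in>UNIV. integral (cbox 0 1) (\<lambda>x. partials [i, i] (u t) x * ?\<phi> x))"
    proof -
      have "continuous_on UNIV (partials [i, i] (u t))" for i
        using C2[OF t] by (simp add: Ck_def del: partials.simps)
      then have "continuous_on (cbox 0 1) (\<lambda>x. partials [i, i] (u t) x * ?\<phi> x)" for i
        by (intro continuous_on_mult continuous_on_trig) (rule continuous_on_subset, auto)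
      then show ?thesis
        by (simp only: sum_distrib_right) (intro integral_sum integrable_continuous; simp)
    qed
    also have "\<dots> = - ?lam * M t"
      using per[of t] t
      by (simp add: integral_second_partial_trig[OF C2[OF t]] M_def laplace_symbol_eq sum_negf
          sum_distrib_right del: partials.simps)
    finally show ?thesis .
  qed
  have "\<exists>c. \<forall>t\<in>{0<..<T}. exp (?lam * t) * M t = c"
  proof (rule has_field_derivative_zero_constant)
    show "((\<lambda>t. exp (?lam * t) * M t) has_real_derivative 0) (at t within {0<..<T})"
      if "t \<in> {0<..<T}" for t
      using derM[OF that] by (auto intro!: derivative_eq_intros)
  qed simp
  then obtain c where c: "\<And>t. t \<in> {0<..<T} \<Longrightarrow> exp (?lam * t) * M t = c" by blast
  have Mc: "M t = exp (- ?lam * t) * c" if "t \<in> {0<..<T}" for t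
    using c[OF that] by (simp add: exp_minus field_simps)
  have M_inner: "M t = L2_inner (u t) ?\<phi>" if "t \<in> {0<..T}" for t
    unfolding M_def using that by (intro L2_inner_eq[symmetric] cont continuous_on_trig)
  have "((\<lambda>t. exp (- ?lam * t) * c) \<longlongrightarrow> exp (- ?lam * 0) * c) (at_right 0)"
    by (intro tendsto_intros)
  moreover have "((\<lambda>t. exp (- ?lam * t) * c) \<longlongrightarrow> f ?\<phi>) (at_right 0)"
  proof -
    have "((\<lambda>t. L2_inner (u t) ?\<phi>) \<longlongrightarrow> f ?\<phi>) (at_right 0)"
      using sol test_fun_trig unfolding heat_solution_def by blast
    moreover have "\<forall>\<^sub>F t in at_right 0. L2_inner (u t) ?\<phi> = exp (- ?lam * t) * c"
      using eventually_at_right_real[OF T]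
    proof eventually_elim
      case (elim t)
      then show ?case using Mc[of t] M_inner[of t] by simp
    qed
    ultimately show ?thesis by (rule Lim_transform_eventually)
  qed
  ultimately have "exp (- ?lam * 0) * c = f ?\<phi>"
    by (rule tendsto_unique[OF trivial_limit_at_right_real])
  then have cf: "c = f ?\<phi>" by simp
  have "((\<lambda>t. exp (- ?lam * t) * c) \<longlongrightarrow> exp (- ?lam * T) * c) (at_left T)"
    by (intro tendsto_intros)
  moreover have "\<forall>\<^sub>F t in at_left T. exp (- ?lam * t) * c = M t"
    using eventually_at_left_real[OF T] by eventually_elim (simp add: Mc)
  ultimately have "(M \<longlongrightarrow> exp (- ?lam * T) * c) (at_left T)"
    by (rule Lim_transform_eventually)
  moreover have "(M \<longlongrightarrow> M T) (at_left T)"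
  proof (rule continuous_on_Icc_at_leftD)
    show "continuous_on {T / 2..T} M"
      using T by (intro continuous_on_subset[OF contM]) auto
  qed (use T in simp)
  ultimately have "exp (- ?lam * T) * c = M T"
    by (rule tendsto_unique[OF trivial_limit_at_left_real])
  then show ?thesis using M_inner[of T] T cf by simp
qed

lemma L2_inner_minus [simp]: "L2_inner (\<lambda>x. - f x) g = - L2_inner f g"
  by (simp add: L2_inner_def)

lemma Lp_norm_2_eq: "Lp_norm 2 g = sqrt (LINT x|torus. (norm (g x))\<^sup>2)"
  by (simp add: Lp_norm_def powr_half_sqrt powr_numeral)

text \<open>The damped cosine \<open>\<phi>\<close> has the same Fourier coefficients as
  \<open>u T\<close>, so their difference has norm 0. That is enough:
  \<open>u\<^sup>2 \<le> 2 * w\<^sup>2 + 2 * \<phi>\<^sup>2\<close> costs a constant factor, which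
  the logarithm in the rate absorbs.\<close>

lemma heat_trig_dist_bound:
  fixes u :: "real \<Rightarrow> real^'d \<Rightarrow> real"
  assumes T: "0 < T" and sol: "heat_solution T (trig_dist k a) u"
  shows "Lp_norm 2 (u T) \<le> 2 * (exp (- laplace_symbol k * T) * \<bar>a\<bar>)"
proof -
  define b where "b = exp (- laplace_symbol k * T) * a"
  define \<phi> where "\<phi> = trig k b 0"
  have \<phi>_eq: "\<phi> = (\<lambda>x. exp (- laplace_symbol k * T) * trig k a 0 x)"
    by (simp add: \<phi>_def b_def trig_def fun_eq_iff mult.assoc)
  let ?w = "\<lambda>x. u T x - \<phi> x"
  have per: "torus_periodic (u T)"
    using sol T by (simp add: heat_solution_def)
  have "continuous_on ({0<..T} \<times> UNIV) (\<lambda>(t, x). u t x)"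
    using sol by (simp add: heat_solution_def)
  then have cu: "continuous_on UNIV (u T)"
    using T by (rule_tac continuous_on_slice) auto
  have c\<phi>: "continuous_on UNIV \<phi>" unfolding \<phi>_def by (rule continuous_on_trig)
  have cw: "continuous_on UNIV ?w" by (intro continuous_intros cu c\<phi>)
  have "L2_inner ?w (trig l c d) = 0" for l c d
  proof -
    have "L2_inner ?w (trig l c d) = L2_inner (trig l c d) (\<lambda>x. u T x + (- 1) * \<phi> x)"
      by (simp add: L2_inner_commute)
    also have "\<dots> = L2_inner (u T) (trig l c d) - L2_inner \<phi> (trig l c d)"
      by (subst L2_inner_continuous_add)
        (auto intro!: continuous_intros continuous_on_trig cu c\<phi> simp: L2_inner_commute L2_inner_minus)
    also have "L2_inner (u T) (trig l c d) =
        exp (- laplace_symbol l * T) * L2_inner (trig k a 0) (trig l c d)"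
      by (simp add: heat_solution_coefficient[OF T sol] trig_dist_def test_fun_trig)
    also have "\<dots> = L2_inner \<phi> (trig l c d)"
    \<comment> \<open>Only \<open>k\<close> and \<open>- k\<close> occur in the initial value, and
      both are damped by the same factor.\<close>
    proof (cases "l = k \<or> l = - k")
      case True
      then have "laplace_symbol l = laplace_symbol k"
        by (auto simp: laplace_symbol_def freq_minus)
      then show ?thesis by (simp only: \<phi>_eq L2_inner_mult_left)
    next
      case False
      then have "k \<noteq> l" "k + l \<noteq> 0"
        by (auto simp: eq_neg_iff_add_eq_0 add.commute)
      then show ?thesis
        by (simp add: \<phi>_eq L2_inner_trig)
    qed
    finally show ?thesis by simp
  qed
  moreover have "torus_periodic ?w"
    using per torus_periodic_trig[of k b 0] unfolding torus_periodic_def \<phi>_def by simp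
  ultimately have w0: "L2_inner ?w ?w = 0"
    by (intro torus_fourier_complete[OF cw])
  have "(LINT x|torus. (u T x)\<^sup>2) \<le> (LINT x|torus. 2 * (?w x * ?w x) + 2 * (\<phi> x * \<phi> x))"
  proof (rule integral_mono)
    show "(u T x)\<^sup>2 \<le> 2 * (?w x * ?w x) + 2 * (\<phi> x * \<phi> x)" for x
      using zero_le_power2[of "u T x - 2 * \<phi> x"] by (simp add: power2_eq_square algebra_simps)
  qed (intro integrable_torus continuous_intros cu c\<phi>)+
  also have "\<dots> = 2 * L2_inner ?w ?w + 2 * L2_inner \<phi> \<phi>"
    unfolding L2_inner_def
    by (subst Bochner_Integration.integral_add) (auto intro!: integrable_torus continuous_intros cu c\<phi>)
  also have "\<dots> = 2 * L2_inner \<phi> \<phi>" using w0 by simp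
  also have "L2_inner \<phi> \<phi> \<le> \<bar>b\<bar> * \<bar>b\<bar>"
    using L2_inner_bound[OF c\<phi> c\<phi>, of "\<bar>b\<bar>" "\<bar>b\<bar>"] by (auto simp: \<phi>_def trig_bound)
  finally have "(LINT x|torus. (u T x)\<^sup>2) \<le> 2 * (b * b)" by simp
  moreover have "(2 * \<bar>b\<bar>)\<^sup>2 = 4 * (b * b)" by (simp add: power2_eq_square)
  moreover have "0 \<le> b * b" by simp
  ultimately have "(LINT x|torus. (u T x)\<^sup>2) \<le> (2 * \<bar>b\<bar>)\<^sup>2" by linarith
  then have "Lp_norm 2 (u T) \<le> 2 * \<bar>b\<bar>"
    unfolding Lp_norm_2_eq by (intro real_le_lsqrt) auto
  then show ?thesis by (simp add: b_def abs_mult)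
qed

section \<open>Besov spaces\<close>

lemma powr_add_le:
  fixes x y p :: real
  assumes "0 \<le> x" "0 \<le> y" "0 \<le> p"
  shows "(x + y) powr p \<le> 2 powr p * (x powr p + y powr p)"
proof -
  have "(x + y) powr p \<le> (2 * max x y) powr p"
    using assms by (intro powr_mono2) auto
  also have "\<dots> = 2 powr p * max x y powr p"
    using assms by (simp add: powr_mult)
  also have "max x y powr p \<le> x powr p + y powr p"
    by (auto simp: max_def)
  finally show ?thesis by simp
qed

lemma fourier_coeff_add: "fourier_coeff (\<lambda>\<phi>. u \<phi> + v \<phi>) k = fourier_coeff u k + fourier_coeff v k"
  by (simp add: fourier_coeff_def complex_eq_iff)

lemma fourier_coeff_cmult: "fourier_coeff (\<lambda>\<phi>. c * u \<phi>) k = of_real c * fourier_coeff u k"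
  by (simp add: fourier_coeff_def complex_eq_iff)

lemma lp_block_add: "lp_block \<eta> j (\<lambda>\<phi>. u \<phi> + v \<phi>) x = lp_block \<eta> j u x + lp_block \<eta> j v x"
  by (simp add: lp_block_def fourier_coeff_add distrib_left distrib_right sum.distrib)

lemma lp_block_cmult: "lp_block \<eta> j (\<lambda>\<phi>. c * u \<phi>) x = of_real c * lp_block \<eta> j u x"
  by (simp add: lp_block_def fourier_coeff_cmult sum_distrib_left mult_ac)

lemma continuous_on_lp_block: "continuous_on A (lp_block \<eta> j u)"
  unfolding lp_block_def by (intro continuous_intros)

text \<open>The constant is 2 * 2, from \<open>powr_add_le\<close> applied pointwise and then to the
  integrals. A triangle inequality up to a constant suffices for the closure of Besov spaces under
  sums; errors are measured in \<open>N0\<close>, which is subadditive by assumption.\<close>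

lemma Lp_norm_add_le:
  fixes f g :: "real^'d \<Rightarrow> 'b::real_normed_vector"
  assumes p: "1 \<le> p" and f: "continuous_on UNIV f" and g: "continuous_on UNIV g"
  shows "Lp_norm p (\<lambda>x. f x + g x) \<le> 4 * (Lp_norm p f + Lp_norm p g)"
proof -
  have int: "integrable torus (\<lambda>x. norm (h x) powr p)"
    if "continuous_on UNIV h" for h :: "real^'d \<Rightarrow> 'b"
    using p that by (intro integrable_torus continuous_on_powr' continuous_intros) auto
  let ?F = "LINT x|torus. norm (f x) powr p" and ?G = "LINT x|torus. norm (g x) powr p"
  have FG: "0 \<le> ?F" "0 \<le> ?G" by auto
  have "(LINT x|torus. norm (f x + g x) powr p) \<le>
      (LINT x|torus. 2 powr p * (norm (f x) powr p + norm (g x) powr p))"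
  proof (rule integral_mono)
    fix x
    have "norm (f x + g x) powr p \<le> (norm (f x) + norm (g x)) powr p"
      using p by (intro powr_mono2 norm_triangle_ineq) auto
    also have "\<dots> \<le> 2 powr p * (norm (f x) powr p + norm (g x) powr p)"
      using p by (intro powr_add_le) auto
    finally show "norm (f x + g x) powr p \<le> 2 powr p * (norm (f x) powr p + norm (g x) powr p)" .
  qed (intro Bochner_Integration.integrable_add integrable_mult_right int continuous_intros f g)+
  also have "\<dots> = 2 powr p * (?F + ?G)"
    using int[OF f] int[OF g] by simp
  finally have "Lp_norm p (\<lambda>x. f x + g x) \<le> (2 powr p * (?F + ?G)) powr (1 / p)"
    unfolding Lp_norm_def using p by (intro powr_mono2) auto
  also have "\<dots> = 2 * (?F + ?G) powr (1 / p)"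
    using p FG by (simp add: powr_mult powr_powr)
  also have "(?F + ?G) powr (1 / p) \<le> 2 powr (1 / p) * (?F powr (1 / p) + ?G powr (1 / p))"
    using p FG by (intro powr_add_le) auto
  also have "2 powr (1 / p) \<le> (2::real) powr 1"
    using p by (intro powr_mono) auto
  finally show ?thesis
    by (simp add: Lp_norm_def mult_right_mono)
qed

lemma Lp_norm_cmult:
  fixes f :: "real^'d \<Rightarrow> 'b::real_normed_algebra_1"
  assumes "p > 0"
  shows "Lp_norm p (\<lambda>x. of_real c * f x) = \<bar>c\<bar> * Lp_norm p f"
proof -
  have "norm (of_real c * f x) = \<bar>c\<bar> * norm (f x)" for x
    by (metis norm_scaleR scaleR_conv_of_real)
  then show ?thesis
    using assms by (simp add: Lp_norm_def powr_mult powr_powr)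
qed

text \<open>Serves sums, with the constant 4 of \<open>Lp_norm_add_le\<close>, and multiples, with
  \<open>K = \<bar>c\<bar>\<close> and both sequences equal.\<close>

lemma lq_mem_bound:
  assumes q: "1 \<le> q" and a: "\<And>j. \<bar>a j\<bar> \<le> K * (\<bar>b j\<bar> + \<bar>c j\<bar>)" and K: "0 \<le> K"
    and b: "lq_mem q b" and c: "lq_mem q c"
  shows "lq_mem q a"
proof (cases "q = \<infinity>")
  case True
  from b c True obtain B C where "\<And>j. \<bar>b j\<bar> \<le> B" "\<And>j. \<bar>c j\<bar> \<le> C"
    by (auto simp: lq_mem_def bdd_above_def)
  then have "\<bar>a j\<bar> \<le> K * (B + C)" for j
    by (intro order_trans[OF a] mult_left_mono add_mono K)
  with True show ?thesis by (auto simp: lq_mem_def bdd_above_def)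
next
  case False
  with q obtain r where r: "q = ereal r" "1 \<le> r" by (cases q) auto
  have "summable (\<lambda>j. \<bar>a j\<bar> powr r)"
  proof (rule summable_comparison_test')
    show "summable (\<lambda>j. K powr r * (2 powr r * (\<bar>b j\<bar> powr r + \<bar>c j\<bar> powr r)))"
      using b c r by (intro summable_mult summable_add) (auto simp: lq_mem_def)
    fix j
    have "\<bar>a j\<bar> powr r \<le> (K * (\<bar>b j\<bar> + \<bar>c j\<bar>)) powr r"
      using a r by (intro powr_mono2) auto
    also have "\<dots> = K powr r * (\<bar>b j\<bar> + \<bar>c j\<bar>) powr r"
      using K by (simp add: powr_mult)
    also have "\<dots> \<le> K powr r * (2 powr r * (\<bar>b j\<bar> powr r + \<bar>c j\<bar> powr r))"
      using r by (intro mult_left_mono powr_add_le) auto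
    finally show "norm (\<bar>a j\<bar> powr r) \<le> K powr r * (2 powr r * (\<bar>b j\<bar> powr r + \<bar>c j\<bar> powr r))"
      by simp
  qed
  with r show ?thesis by (simp add: lq_mem_def)
qed

lemma distributions_bound:
  assumes "u \<in> distributions"
  shows "\<exists>m C. \<forall>\<phi> M. test_fun \<phi> \<and> (\<forall>ds x. length ds \<le> m \<longrightarrow> \<bar>partials ds \<phi> x\<bar> \<le> M)
    \<longrightarrow> \<bar>u \<phi>\<bar> \<le> C * M"
  using assms by (simp add: distributions_def)

lemma distributions_add:
  assumes "u \<in> distributions" "v \<in> distributions"
  shows "(\<lambda>\<phi>. u \<phi> + v \<phi>) \<in> distributions"
proof -
  from distributions_bound[OF assms(1)] distributions_bound[OF assms(2)]
  obtain m C m' C' where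
    u: "\<And>\<phi> M. test_fun \<phi> \<Longrightarrow> (\<And>ds x. length ds \<le> m \<Longrightarrow> \<bar>partials ds \<phi> x\<bar> \<le> M) \<Longrightarrow> \<bar>u \<phi>\<bar> \<le> C * M" and
    v: "\<And>\<phi> M. test_fun \<phi> \<Longrightarrow> (\<And>ds x. length ds \<le> m' \<Longrightarrow> \<bar>partials ds \<phi> x\<bar> \<le> M) \<Longrightarrow> \<bar>v \<phi>\<bar> \<le> C' * M"
    by metis
  have "\<bar>u \<phi> + v \<phi>\<bar> \<le> (C + C') * M"
    if "test_fun \<phi>" "\<And>ds x. length ds \<le> max m m' \<Longrightarrow> \<bar>partials ds \<phi> x\<bar> \<le> M" for \<phi> M
    using u[of \<phi> M] v[of \<phi> M] that by (simp add: distrib_right)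
  then have "\<exists>m C. \<forall>\<phi> M. test_fun \<phi> \<and> (\<forall>ds x. length ds \<le> m \<longrightarrow> \<bar>partials ds \<phi> x\<bar> \<le> M)
        \<longrightarrow> \<bar>u \<phi> + v \<phi>\<bar> \<le> C * M"
    by blast
  with assms show ?thesis
    unfolding distributions_def by (simp add: distrib_left)
qed

lemma distributions_cmult:
  assumes "u \<in> distributions"
  shows "(\<lambda>\<phi>. c * u \<phi>) \<in> distributions"
proof -
  from distributions_bound[OF assms] obtain m C where
    u: "\<And>\<phi> M. test_fun \<phi> \<Longrightarrow> (\<And>ds x. length ds \<le> m \<Longrightarrow> \<bar>partials ds \<phi> x\<bar> \<le> M) \<Longrightarrow> \<bar>u \<phi>\<bar> \<le> C * M"
    by metis
  have "\<bar>c * u \<phi>\<bar> \<le> (\<bar>c\<bar> * C) * M"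
    if "test_fun \<phi>" "\<And>ds x. length ds \<le> m \<Longrightarrow> \<bar>partials ds \<phi> x\<bar> \<le> M" for \<phi> M
    using mult_left_mono[OF u[OF that] abs_ge_zero[of c]] by (simp add: abs_mult mult.assoc)
  then have "\<exists>m C. \<forall>\<phi> M. test_fun \<phi> \<and> (\<forall>ds x. length ds \<le> m \<longrightarrow> \<bar>partials ds \<phi> x\<bar> \<le> M)
        \<longrightarrow> \<bar>c * u \<phi>\<bar> \<le> C * M"
    by blast
  with assms show ?thesis
    unfolding distributions_def by (simp add: algebra_simps)
qed

lemma besov_seq_nonneg [simp]: "0 \<le> besov_seq \<eta> s p u j"
  by (simp add: besov_seq_def)

lemma besov_space_add:
  assumes pq: "1 \<le> p" "1 \<le> q" and u: "u \<in> besov_space \<eta> s p q" and v: "v \<in> besov_space \<eta> s p q"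
  shows "(\<lambda>\<phi>. u \<phi> + v \<phi>) \<in> besov_space \<eta> s p q"
proof -
  have "besov_seq \<eta> s p (\<lambda>\<phi>. u \<phi> + v \<phi>) j \<le> 4 * (besov_seq \<eta> s p u j + besov_seq \<eta> s p v j)" for j
  proof -
    have "lp_block \<eta> j (\<lambda>\<phi>. u \<phi> + v \<phi>) = (\<lambda>x. lp_block \<eta> j u x + lp_block \<eta> j v x)"
      by (simp add: fun_eq_iff lp_block_add)
    then show ?thesis
      using mult_left_mono[OF Lp_norm_add_le[OF pq(1) continuous_on_lp_block continuous_on_lp_block,
          of \<eta> j u \<eta> j v], of "2 powr (real j * s)"]
      by (simp add: besov_seq_def algebra_simps)
  qed
  then show ?thesis
    using u v lq_mem_bound[OF pq(2), of "besov_seq \<eta> s p (\<lambda>\<phi>. u \<phi> + v \<phi>)" 4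
        "besov_seq \<eta> s p u" "besov_seq \<eta> s p v"]
    by (auto simp: besov_space_def distributions_add)
qed

lemma besov_space_cmult:
  assumes pq: "1 \<le> p" "1 \<le> q" and u: "u \<in> besov_space \<eta> s p q"
  shows "(\<lambda>\<phi>. c * u \<phi>) \<in> besov_space \<eta> s p q"
proof -
  have "besov_seq \<eta> s p (\<lambda>\<phi>. c * u \<phi>) j = \<bar>c\<bar> * besov_seq \<eta> s p u j" for j
  proof -
    have "lp_block \<eta> j (\<lambda>\<phi>. c * u \<phi>) = (\<lambda>x. of_real c * lp_block \<eta> j u x)"
      by (simp add: fun_eq_iff lp_block_cmult)
    then show ?thesis
      using pq by (simp add: besov_seq_def Lp_norm_cmult)
  qed
  then show ?thesis
    using u lq_mem_bound[OF pq(2), of "besov_seq \<eta> s p (\<lambda>\<phi>. c * u \<phi>)" "\<bar>c\<bar>"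
        "besov_seq \<eta> s p u" "besov_seq \<eta> s p u"]
    by (auto simp: besov_space_def distributions_cmult mult_left_mono)
qed

lemma besov_space_diff:
  assumes pq: "1 \<le> p" "1 \<le> q" and u: "u \<in> besov_space \<eta> s p q" and v: "v \<in> besov_space \<eta> s p q"
  shows "u - v \<in> besov_space \<eta> s p q"
  using besov_space_add[OF pq u besov_space_cmult[OF pq v, of "- 1"]] by (simp add: fun_diff_def)

lemma trig_dist_cmult: "trig_dist k (c * a) \<phi> = c * trig_dist k a \<phi>"
proof -
  have "trig k (c * a) 0 = (\<lambda>x. c * trig k a 0 x)" by (simp add: trig_def fun_eq_iff)
  then show ?thesis by (simp add: trig_dist_def)
qed

lemma lq_norm_single:
  assumes "1 \<le> q" "0 \<le> c"
  shows "lq_mem q (\<lambda>j. if j = n then c else 0)" "lq_norm q (\<lambda>j. if j = n then c else 0) = c"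
proof -
  let ?a = "\<lambda>j. if j = n then c else 0"
  have "lq_mem q ?a \<and> lq_norm q ?a = c"
  proof (cases "q = \<infinity>")
    case True
    have "bdd_above (range (\<lambda>j. \<bar>?a j\<bar>))"
      using assms by (auto simp: bdd_above_def)
    moreover from this have "(SUP j. \<bar>?a j\<bar>) = c"
      using assms by (intro antisym cSUP_least cSUP_upper2[of _ _ n]) auto
    ultimately show ?thesis using True by (simp add: lq_mem_def lq_norm_def)
  next
    case False
    with assms obtain r where r: "q = ereal r" "1 \<le> r" by (cases q) auto
    have "(\<lambda>j. \<bar>?a j\<bar> powr r) = (\<lambda>j. if j = n then c powr r else 0)"
      using assms by auto
    then have "(\<lambda>j. \<bar>?a j\<bar> powr r) sums (c powr r)"
      using sums_single[of n "\<lambda>_. c powr r"] by simp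
    then show ?thesis
      using r assms by (simp add: lq_mem_def lq_norm_def sums_iff powr_powr)
  qed
  then show "lq_mem q ?a" "lq_norm q ?a = c" by auto
qed

text \<open>With a single nonzero block the summation index does not matter. The same mode can
  therefore be measured in the smoothness norm, with weight \<open>2 powr (n * s)\<close>, and in
  the error norm, with weight 1.\<close>

lemma besov_trig_dist:
  fixes \<eta> :: "real^'d \<Rightarrow> real"
  assumes \<eta>: "lp_cutoff \<eta>" and k: "norm (freq k) = 2 ^ n" and p: "1 \<le> p" "p \<le> 2" and q: "1 \<le> q"
  shows "trig_dist k a \<in> besov_space \<eta> s p q"
    and "besov_norm \<eta> s p q (trig_dist k a) \<le> 2 powr (real n * s) * \<bar>a\<bar>"
    and "2 powr (real n * s) * (\<bar>a\<bar> / 2) \<le> besov_norm \<eta> s p q (trig_dist k a)"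
proof -
  let ?L = "Lp_norm p (\<lambda>x. complex_of_real (trig k a 0 x))"
  have k0: "k \<noteq> 0" using k by (auto simp: freq_def zero_vec_def[symmetric])
  have "Lp_norm p (\<lambda>x::real^'d. 0::complex) = 0" using p by (simp add: Lp_norm_def)
  then have seq: "besov_seq \<eta> s p (trig_dist k a) = (\<lambda>j. if j = n then 2 powr (real n * s) * ?L else 0)"
    by (auto simp: besov_seq_def lp_block_trig_dist[OF \<eta> k] fun_eq_iff)
  note single = lq_norm_single[OF q, of "2 powr (real n * s) * ?L" n]
  show "trig_dist k a \<in> besov_space \<eta> s p q"
    using single(1) by (simp add: besov_space_def seq trig_dist_distribution)
  have "besov_norm \<eta> s p q (trig_dist k a) = 2 powr (real n * s) * ?L"
    using single(2) by (simp add: besov_norm_def seq)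
  then show "besov_norm \<eta> s p q (trig_dist k a) \<le> 2 powr (real n * s) * \<bar>a\<bar>"
    "2 powr (real n * s) * (\<bar>a\<bar> / 2) \<le> besov_norm \<eta> s p q (trig_dist k a)"
    using Lp_norm_trig[OF p k0, of a] by (auto intro: mult_left_mono)
qed

section \<open>The lower bound\<close>

lemma filterlim_four_power:
  fixes c :: real
  assumes "c > 0"
  shows "filterlim (\<lambda>n. c * 4 ^ n) at_top sequentially"
proof (rule filterlim_at_infinity_imp_filterlim_at_top)
  show "filterlim (\<lambda>n. c * 4 ^ n) at_infinity sequentially"
    using assms
    by (intro tendsto_mult_filterlim_at_infinity[OF tendsto_const] filterlim_realpow_sequentially_gt1) auto
qed (use assms in simp)

text \<open>The logarithm equals \<open>2 * c * 4 ^ n - ln b\<close>. The factor 2 leaves room for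
  \<open>ln b\<close>: eventually the value is at least \<open>c * 4 ^ n\<close>, whose power - s/2
  is a multiple of \<open>2 powr (- (n * s))\<close>.\<close>

lemma log_rate_at_exp:
  fixes b c s :: real
  assumes c: "c > 0" and s: "s > 0" and b: "b > 0" and \<rho>: "\<rho> > 0"
  shows "\<forall>\<^sub>F n in sequentially.
    log_rate s \<rho> (\<rho> * b * exp (- (2 * c * 4 ^ n))) \<le> \<rho> * (c powr (- s / 2) * 2 powr (- (real n * s)))"
proof -
  have "filterlim (\<lambda>n. c * 4 ^ n) at_top sequentially"
    using c by (rule filterlim_four_power)
  then have "\<forall>\<^sub>F n in sequentially. ln b \<le> c * 4 ^ n"
    by (simp add: filterlim_at_top)
  then show ?thesis
  proof eventually_elim
    case (elim n)
    have "\<rho> / (\<rho> * b * exp (- (2 * c * 4 ^ n))) = exp (2 * c * 4 ^ n - ln b)"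
      using \<rho> b by (simp add: exp_diff exp_minus field_simps)
    then have "c * 4 ^ n \<le> ln (\<rho> / (\<rho> * b * exp (- (2 * c * 4 ^ n))))"
      using elim by simp
    then have "ln (\<rho> / (\<rho> * b * exp (- (2 * c * 4 ^ n)))) powr (- s / 2) \<le> (c * 4 ^ n) powr (- s / 2)"
      using c s by (intro powr_mono2') auto
    also have "\<dots> = c powr (- s / 2) * 2 powr (- (real n * s))"
    proof -
      have "(4::real) ^ n = 2 powr (2 * real n)"
        by (simp add: powr_mult powr_powr[symmetric] powr_realpow)
      then show ?thesis using c by (simp add: powr_mult powr_powr)
    qed
    finally show ?case
      using \<rho> by (simp add: log_rate_def)
  qed
qed

text \<open>The method may depend on \<delta>, so that every choice of a regularization parameter in
  terms of the noise level is included; a fixed method is a constant family.\<close>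

lemma no_faster_rate:
  fixes \<eta> :: "real^'d \<Rightarrow> real"
    and N0 Ns :: "'d distribution \<Rightarrow> real"
    and T :: "'d distribution \<Rightarrow> real^'d \<Rightarrow> real"
  assumes tbar: "tbar > 0" and p: "1 \<le> p" "p \<le> 2" and q: "1 \<le> q" and s: "s > 0"
    and \<eta>: "lp_cutoff \<eta>"
    and N0: "equivalent_besov_norm \<eta> 0 p q N0"
    and Ns: "equivalent_besov_norm \<eta> s p \<infinity> Ns"
    and T: "heat_operator tbar (besov_space \<eta> 0 p q) T"
    and \<rho>: "\<rho> > 0"
    and R: "\<forall>\<delta>>0. reconstruction_method (besov_space \<eta> 0 p q) (R \<delta>)"
  shows "\<not> little_o_at_0 (\<lambda>\<delta>. worst_case_error N0 (besov_space \<eta> s p \<infinity>) Ns T \<rho> \<delta> (R \<delta>)) (log_rate s \<rho>)"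
proof
  let ?V = "besov_space \<eta> 0 p q"
  let ?E = "\<lambda>\<delta>. worst_case_error N0 (besov_space \<eta> s p \<infinity>) Ns T \<rho> \<delta> (R \<delta>)"
  assume o: "little_o_at_0 ?E (log_rate s \<rho>)"
  from N0 obtain a where a: "a > 0" "\<And>u. u \<in> ?V \<Longrightarrow> a * besov_norm \<eta> 0 p q u \<le> N0 u"
    unfolding equivalent_besov_norm_def by blast
  from N0 have N0_add: "N0 (\<lambda>\<phi>. u \<phi> + v \<phi>) \<le> N0 u + N0 v" if "u \<in> ?V" "v \<in> ?V" for u v
    using that unfolding equivalent_besov_norm_def by blast
  from N0 have N0_cmult: "N0 (\<lambda>\<phi>. c * u \<phi>) = \<bar>c\<bar> * N0 u" if "u \<in> ?V" for c u
    using that unfolding equivalent_besov_norm_def by blast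
  from Ns obtain b where b: "b > 0"
    "\<And>u. u \<in> besov_space \<eta> s p \<infinity> \<Longrightarrow> Ns u \<le> b * besov_norm \<eta> s p \<infinity> u"
    unfolding equivalent_besov_norm_def by blast
  define i :: 'd where "i = undefined"
  define k :: "nat \<Rightarrow> int^'d" where "k n = axis i (2 ^ n)" for n
  \<comment> \<open>\<open>amp n\<close> makes the bound \<open>b * (2 powr (n * s) * amp n)\<close>
    for \<open>Ns\<close> equal to \<rho>. With this \<open>c\<close> the damping exponent of the
    mode is \<open>2 * c * 4 ^ n\<close>. In \<delta> the amplitude is replaced by its bound
    \<open>\<rho> / b\<close>, which leaves a pure exponential.\<close>
  define amp where "amp n = \<rho> / b * 2 powr (- (real n * s))" for n
  define c where "c = 2 * pi\<^sup>2 * tbar"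
  define \<delta> where "\<delta> n = \<rho> * (2 / b) * exp (- (2 * c * 4 ^ n))" for n
  have c: "c > 0" using tbar by (simp add: c_def)
  have \<delta>_pos: "\<delta> n > 0" for n using \<rho> b by (simp add: \<delta>_def)
  have amp: "amp n > 0" "amp n \<le> \<rho> / b" for n
  proof -
    have "2 powr (- (real n * s)) \<le> 2 powr 0"
      using s by (intro powr_mono) auto
    then show "amp n > 0" "amp n \<le> \<rho> / b"
      using \<rho> b mult_left_le[of "2 powr (- (real n * s))" "\<rho> / b"] by (auto simp: amp_def)
  qed
  have k: "norm (freq (k n)) = 2 ^ n" for n
  proof -
    have "freq (k n) = 2 ^ n *\<^sub>R axis i 1" by (simp add: k_def freq_def vec_eq_iff axis_def)
    then show ?thesis by (simp add: norm_axis_1)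
  qed
  note trig_dist = besov_trig_dist[OF \<eta> k p]
  have lower: "ereal (a * amp n / 2) \<le> ?E (\<delta> n)" for n
  proof -
    define r where "r = R (\<delta> n) (\<lambda>_. 0)"
    have L2_0: "L2_fun (\<lambda>_ :: real^'d. 0)"
      by (simp add: L2_fun_def torus_periodic_def)
    then have r: "r \<in> ?V"
      using R \<delta>_pos unfolding r_def reconstruction_method_def by blast
    have le: "ereal (N0 (trig_dist (k n) x - r)) \<le> ?E (\<delta> n)" if x: "\<bar>x\<bar> = amp n" for x
    proof -
      have V: "trig_dist (k n) x \<in> ?V" "trig_dist (k n) x \<in> besov_space \<eta> s p \<infinity>"
        using trig_dist(1) q by simp_all
      have "Ns (trig_dist (k n) x) \<le> b * (2 powr (real n * s) * \<bar>x\<bar>)"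
        using b trig_dist(2)[of \<infinity> s n x] by (intro order_trans[OF b(2)[OF V(2)]] mult_left_mono) auto
      also have "\<dots> = \<rho> * (2 powr (real n * s) * 2 powr (- (real n * s)))"
        using b by (simp add: x amp_def)
      also have "\<dots> = \<rho>" by (simp flip: powr_add)
      finally have 1: "Ns (trig_dist (k n) x) \<le> \<rho>" .
      obtain u where u: "heat_solution tbar (trig_dist (k n) x) u" "T (trig_dist (k n) x) = u tbar"
        using T V unfolding heat_operator_def by blast
      have "Lp_norm 2 (T (trig_dist (k n) x)) \<le> 2 * (exp (- laplace_symbol (k n) * tbar) * amp n)"
        using heat_trig_dist_bound[OF tbar u(1)] by (simp add: u(2) x)
      also have "laplace_symbol (k n) * tbar = 2 * c * 4 ^ n"
      proof -
        have "((2::real) ^ n)\<^sup>2 = 4 ^ n" by (simp flip: power_mult add: mult.commute[of n] power_mult)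
        then show ?thesis by (simp add: laplace_symbol_def k c_def power_mult_distrib)
      qed
      then have "2 * (exp (- laplace_symbol (k n) * tbar) * amp n) = 2 * (exp (- (2 * c * 4 ^ n)) * amp n)"
        by simp
      also have "\<dots> \<le> 2 * (exp (- (2 * c * 4 ^ n)) * (\<rho> / b))"
        using amp by (intro mult_left_mono) auto
      finally have 2: "Lp_norm 2 (T (trig_dist (k n) x) - (\<lambda>_. 0)) \<le> \<delta> n"
        by (simp add: \<delta>_def fun_diff_def mult_ac)
      show ?thesis
        unfolding worst_case_error_def r_def using V(2) 1 2 L2_0 by (intro Sup_upper) blast
    qed
    let ?u = "trig_dist (k n) (amp n) - r" and ?v = "trig_dist (k n) (- amp n) - r"
    have uv: "?u \<in> ?V" "?v \<in> ?V"
      using trig_dist(1) q p r by (auto intro: besov_space_diff)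
    \<comment> \<open>The unknown \<open>r\<close> cancels in the difference of the two errors,
      which is the mode of amplitude \<open>2 * amp n\<close>; the doubling offsets the factor 1/2
      in the lower Besov bound.\<close>
    have "a * amp n \<le> a * besov_norm \<eta> 0 p q (trig_dist (k n) (2 * amp n))"
      using a trig_dist(3)[OF q, of n 0 "2 * amp n"] amp[of n] by (intro mult_left_mono) auto
    also have "\<dots> \<le> N0 (trig_dist (k n) (2 * amp n))"
      by (intro a(2) trig_dist(1) q)
    also have "trig_dist (k n) (2 * amp n) = (\<lambda>\<phi>. ?u \<phi> + (- 1) * ?v \<phi>)"
      using trig_dist_cmult[of "k n" "- 1" "amp n"] trig_dist_cmult[of "k n" 2 "amp n"] by auto
    also have "N0 \<dots> \<le> N0 ?u + N0 (\<lambda>\<phi>. (- 1) * ?v \<phi>)"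
      using uv p q by (intro N0_add besov_space_cmult) (simp_all add: fun_diff_def)
    also have "N0 (\<lambda>\<phi>. (- 1) * ?v \<phi>) = N0 ?v"
      by (subst N0_cmult[OF uv(2)]) simp
    finally have "a * amp n / 2 \<le> N0 ?u \<or> a * amp n / 2 \<le> N0 ?v" by linarith
    then have "ereal (a * amp n / 2) \<le> max (ereal (N0 ?u)) (ereal (N0 ?v))"
      by (simp add: le_max_iff_disj)
    also have "\<dots> \<le> ?E (\<delta> n)"
      using le[of "amp n"] le[of "- amp n"] amp[of n] by simp
    finally show ?thesis .
  qed
  have "(\<lambda>n. \<rho> * (2 / b) * exp (- (2 * c * 4 ^ n))) \<longlonglongrightarrow> \<rho> * (2 / b) * 0"
  proof (intro tendsto_mult tendsto_const filterlim_compose[OF exp_at_bot])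
    have "filterlim (\<lambda>n. (2 * c) * 4 ^ n) at_top sequentially"
      using c by (intro filterlim_four_power) simp
    then show "filterlim (\<lambda>n. - (2 * c * 4 ^ n)) at_bot sequentially"
      by (simp add: filterlim_uminus_at_top)
  qed
  then have "\<delta> \<longlonglongrightarrow> 0"
    by (simp add: \<delta>_def[abs_def])
  then have "filterlim \<delta> (at_right 0) sequentially"
    by (rule tendsto_imp_filterlim_at_right) (simp add: \<delta>_pos)
  \<comment> \<open>Chosen so that \<open>e\<close> times the rate is eventually at most
    \<open>a * amp n / 4\<close>, half of the lower bound.\<close>
  moreover define e where "e = a / (4 * b * c powr (- s / 2))"
  have e: "e > 0" using a b c by (simp add: e_def)
  with o have "\<forall>\<^sub>F \<delta> in at_right 0. ?E \<delta> \<le> ereal (e * log_rate s \<rho> \<delta>)"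
    unfolding little_o_at_0_def by blast
  ultimately have "\<forall>\<^sub>F n in sequentially. ?E (\<delta> n) \<le> ereal (e * log_rate s \<rho> (\<delta> n))"
    by (auto simp: filterlim_iff)
  moreover have "\<forall>\<^sub>F n in sequentially. log_rate s \<rho> (\<delta> n) \<le>
      \<rho> * (c powr (- s / 2) * 2 powr (- (real n * s)))"
    using log_rate_at_exp[OF c s _ \<rho>, of "2 / b"] b unfolding \<delta>_def by simp
  ultimately have "\<forall>\<^sub>F n in sequentially. False"
  proof eventually_elim
    case (elim n)
    have "ereal (a * amp n / 2) \<le> ereal (e * log_rate s \<rho> (\<delta> n))"
      using lower elim(1) by (rule order_trans)
    then have "a * amp n / 2 \<le> e * log_rate s \<rho> (\<delta> n)" by simp
    also have "\<dots> \<le> e * (\<rho> * (c powr (- s / 2) * 2 powr (- (real n * s))))"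
      using elim(2) e by (intro mult_left_mono) auto
    also have "\<dots> = a * amp n / 4"
      using b c by (simp add: e_def amp_def field_simps)
    finally show False using a amp(1)[of n] by simp
  qed
  then show False by simp
qed

section \<open>Uniform convexity of sequence norms\<close>

lemma powr_midpoint:
  fixes x y r :: real
  assumes "0 \<le> x" "0 \<le> y" "1 \<le> r"
  shows "((x + y) / 2) powr r \<le> (x powr r + y powr r) / 2"
proof (cases "x = 0 \<or> y = 0")
  case True
  have "(1 / 2) powr r \<le> (1 / 2 :: real) powr 1"
    using assms by (intro powr_mono') auto
  then have "(z / 2) powr r \<le> z powr r / 2" if "0 \<le> z" for z
    using that mult_left_mono[of "(1 / 2) powr r" "1 / 2" "z powr r"]
    by (simp add: powr_divide)
  then show ?thesis using True assms by auto
next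
  case False
  then show ?thesis
    using convex_onD[OF powr_convex[OF assms(3)], of "1/2" x y] assms
    by (simp add: field_simps)
qed

text \<open>The shares x/(x+y) and y/(x+y) add up to 1 and do not grow when raised to a power r
  \<ge> 1.\<close>

lemma powr_superadditive:
  fixes x y r :: real
  assumes "0 \<le> x" "0 \<le> y" "1 \<le> r"
  shows "x powr r + y powr r \<le> (x + y) powr r"
proof (cases "x + y = 0")
  case False
  with assms have S: "x + y > 0" by simp
  have *: "z powr r \<le> (z / (x + y)) * (x + y) powr r" if "0 \<le> z" "z \<le> x + y" for z
  proof -
    have "(z / (x + y)) powr r \<le> (z / (x + y)) powr 1"
      using that S assms by (intro powr_mono') auto
    then have "(z / (x + y)) powr r * (x + y) powr r \<le> (z / (x + y)) * (x + y) powr r"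
      using that S by (intro mult_right_mono) auto
    then show ?thesis using that S by (simp add: powr_divide)
  qed
  have "x powr r + y powr r \<le> (x / (x + y)) * (x + y) powr r + (y / (x + y)) * (x + y) powr r"
    using assms by (intro add_mono *) auto
  also have "\<dots> = ((x + y) / (x + y)) * (x + y) powr r"
    by (simp only: add_divide_distrib distrib_right)
  also have "\<dots> = (x + y) powr r" using S by simp
  finally show ?thesis .
qed (use assms in \<open>simp add: add_nonneg_eq_0_iff\<close>)

text \<open>On \<open>[0, M]\<close> the second derivative of \<open>t \<mapsto> t powr p\<close> is at least \<open>p (p - 1) M powr (p - 2)\<close>,
  since \<open>p \<le> 2\<close>; hence subtracting the corresponding quadratic leaves a convex function.\<close>

lemma powr_midpoint_quadratic:
  fixes a b p M :: real
  assumes p: "1 < p" "p \<le> 2" and M: "0 < M" and ab: "\<bar>a\<bar> \<le> M" "\<bar>b\<bar> \<le> M"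
  shows "\<bar>(a + b) / 2\<bar> powr p + p * (p - 1) / 8 * M powr (p - 2) * (a - b)\<^sup>2
    \<le> (\<bar>a\<bar> powr p + \<bar>b\<bar> powr p) / 2"
proof -
  \<comment> \<open>\<open>K * t\<^sup>2\<close> has the second derivative p(p-1) M^(p-2). By the
    parallelogram law its midpoint gain is K/4 times the squared difference, whence the 8 in the
    statement.\<close>
  define K where "K = p * (p - 1) / 2 * M powr (p - 2)"
  define g where "g t = t powr p - K * t\<^sup>2" for t
  have convex: "convex_on {0<..M} g"
    unfolding g_def
  proof (rule f''_ge0_imp_convex)
    fix t assume t: "t \<in> {0<..M}"
    show "((\<lambda>t. t powr p - K * t\<^sup>2) has_real_derivative p * t powr (p - 1) - 2 * K * t) (at t)"
      using t by (auto intro!: derivative_eq_intros)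
    show "((\<lambda>t. p * t powr (p - 1) - 2 * K * t) has_real_derivative
        p * ((p - 1) * t powr (p - 2)) - 2 * K) (at t)"
      using t by (auto intro!: derivative_eq_intros simp: diff_diff_eq)
    have "M powr (p - 2) \<le> t powr (p - 2)"
      using t p by (intro powr_mono2') auto
    then show "0 \<le> p * ((p - 1) * t powr (p - 2)) - 2 * K"
      using p by (simp add: K_def mult.assoc)
  qed simp
  have mid: "g ((x + y) / 2) \<le> (g x + g y) / 2" if xy: "0 \<le> x" "x \<le> M" "0 \<le> y" "y \<le> M" for x y
  proof -
    \<comment> \<open>Convexity was shown away from 0 only. \<open>X z t\<close> moves the points
      into (0, M], and letting t tend to 0 gives the closed interval.\<close>
    define X where "X z t = z + t * (M - z)" for z t :: real
    have lim: "((\<lambda>t. X z t) \<longlongrightarrow> z) (at_right 0)" for z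
      unfolding X_def by (auto intro!: tendsto_eq_intros)
    have X: "X z t \<in> {0<..M}" if "0 \<le> z" "z \<le> M" "t \<in> {0<..<1}" for z t
    proof -
      have "X z t = (1 - t) * z + t * M" by (simp add: X_def algebra_simps)
      moreover have "(1 - t) * z + t * M > 0" using that M by (intro add_nonneg_pos) auto
      moreover have "(1 - t) * z + t * M \<le> (1 - t) * M + t * M"
        using that by (intro add_mono mult_left_mono) auto
      ultimately show ?thesis by (simp add: algebra_simps)
    qed
    have ev: "\<forall>\<^sub>F t in at_right (0::real). t \<in> {0<..<1}"
      by (rule eventually_at_right_real) simp
    have limg: "((\<lambda>t. g (f t)) \<longlongrightarrow> g z) (at_right 0)"
      if "(f \<longlongrightarrow> z) (at_right 0)" "\<forall>\<^sub>F t in at_right 0. 0 \<le> f t" for f z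
      unfolding g_def using p that by (intro tendsto_intros tendsto_powr') auto
    have pos: "\<forall>\<^sub>F t in at_right 0. 0 \<le> X z t" if "0 \<le> z" "z \<le> M" for z
      using ev by eventually_elim (use X[OF that] in fastforce)
    show ?thesis
    proof (rule tendsto_le[OF trivial_limit_at_right_real])
      show "((\<lambda>t. g ((X x t + X y t) / 2)) \<longlongrightarrow> g ((x + y) / 2)) (at_right 0)"
      proof (intro limg tendsto_intros lim)
        show "\<forall>\<^sub>F t in at_right 0. 0 \<le> (X x t + X y t) / 2"
          using pos[OF xy(1,2)] pos[OF xy(3,4)] by eventually_elim simp
      qed simp
      show "((\<lambda>t. (g (X x t) + g (X y t)) / 2) \<longlongrightarrow> (g x + g y) / 2) (at_right 0)"
        using pos xy by (intro tendsto_intros limg lim) auto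
      show "\<forall>\<^sub>F t in at_right 0. g ((X x t + X y t) / 2) \<le> (g (X x t) + g (X y t)) / 2"
        using ev
      proof eventually_elim
        case (elim t)
        show ?case
          using convex_onD[OF convex, of "1/2" "X x t" "X y t"] X[OF xy(1,2) elim] X[OF xy(3,4) elim]
          by (simp add: field_simps)
      qed
    qed
  qed
  \<comment> \<open>For \<open>a\<close> and \<open>b\<close> of opposite sign the modulus of the
    midpoint is smaller than the mean of the moduli; monotonicity of \<open>g\<close> closes this
    gap.\<close>
  have mono: "g x \<le> g y" if xy: "0 \<le> x" "x \<le> y" "y \<le> M" for x y
  proof (cases "x = 0")
    case True
    have "K * y\<^sup>2 \<le> y powr p"
    proof (cases "y = 0")
      case False
      with xy have y: "y > 0" by simp
      have "p * (p - 1) \<le> 2 * 1" using p by (intro mult_mono) auto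
      then have "K \<le> 1 * M powr (p - 2)"
        unfolding K_def by (intro mult_right_mono) auto
      also have "\<dots> \<le> y powr (p - 2)" using y xy p by (simp add: powr_mono2')
      finally have "K * y\<^sup>2 \<le> y powr (p - 2) * y\<^sup>2" by (intro mult_right_mono) auto
      also have "y powr (p - 2) * y\<^sup>2 = y powr (p - 2) * y powr 2"
        using y by (simp add: powr_numeral)
      also have "y powr (p - 2) * y powr 2 = y powr p" by (simp flip: powr_add)
      finally show ?thesis .
    qed simp
    with True show ?thesis by (simp add: g_def)
  next
    case False
    show ?thesis
    proof (rule DERIV_nonneg_imp_nondecreasing[OF xy(2)], intro exI conjI)
      fix t assume t: "x \<le> t" "t \<le> y"
      with xy False have t0: "t > 0" "t \<le> M" by auto
      show "(g has_real_derivative p * t powr (p - 1) - 2 * K * t) (at t)"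
        unfolding g_def using t0 by (auto intro!: derivative_eq_intros)
      have "(p - 1) * M powr (p - 2) \<le> 1 * t powr (p - 2)"
        using t0 p by (intro mult_mono powr_mono2') auto
      then have "p * ((p - 1) * M powr (p - 2)) * t \<le> p * t powr (p - 2) * t"
        using t0 p by (intro mult_right_mono mult_left_mono) auto
      also have "p * t powr (p - 2) * t = p * t powr (p - 1)"
        using t0 powr_add[of t "p - 2" 1] by simp
      finally show "0 \<le> p * t powr (p - 1) - 2 * K * t"
        by (simp add: K_def mult.assoc)
    qed
  qed
  have "g \<bar>(a + b) / 2\<bar> \<le> g ((\<bar>a\<bar> + \<bar>b\<bar>) / 2)"
    using ab by (intro mono) auto
  also have "\<dots> \<le> (g \<bar>a\<bar> + g \<bar>b\<bar>) / 2"
    using ab by (intro mid) auto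
  finally have "\<bar>(a + b) / 2\<bar> powr p + K / 4 * (a - b)\<^sup>2 \<le> (\<bar>a\<bar> powr p + \<bar>b\<bar> powr p) / 2"
    by (simp add: g_def power2_eq_square field_simps)
  then show ?thesis by (simp add: K_def)
qed

text \<open>Weighted arithmetic and geometric means, after normalizing both sums to 1. The end
  points of the range of \<open>t\<close> are included because p = 2 leads to the exponents 1 and
  0.\<close>

lemma Holder_sum:
  fixes a b :: "'a \<Rightarrow> real"
  assumes L: "finite L" and a: "\<And>l. l \<in> L \<Longrightarrow> 0 \<le> a l" and b: "\<And>l. l \<in> L \<Longrightarrow> 0 \<le> b l"
    and t: "0 \<le> t" "t \<le> 1"
  shows "(\<Sum>l\<in>L. a l powr t * b l powr (1 - t)) \<le> (\<Sum>l\<in>L. a l) powr t * (\<Sum>l\<in>L. b l) powr (1 - t)"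
proof (cases "(\<Sum>l\<in>L. a l) = 0 \<or> (\<Sum>l\<in>L. b l) = 0")
  case True
  then have "(\<forall>l\<in>L. a l = 0) \<or> (\<forall>l\<in>L. b l = 0)"
    using sum_nonneg_eq_0_iff[OF L a] sum_nonneg_eq_0_iff[OF L b] by auto
  then have "(\<Sum>l\<in>L. a l powr t * b l powr (1 - t)) = 0"
    by (intro sum.neutral) auto
  then show ?thesis by simp
next
  case False
  define A where "A = (\<Sum>l\<in>L. a l)"
  define B where "B = (\<Sum>l\<in>L. b l)"
  have "0 \<le> A" "0 \<le> B" unfolding A_def B_def by (simp_all add: sum_nonneg a b)
  with False have AB: "A > 0" "B > 0" unfolding A_def B_def by auto
  have "(\<Sum>l\<in>L. (a l / A) powr t * (b l / B) powr (1 - t)) \<le> (\<Sum>l\<in>L. t * (a l / A) + (1 - t) * (b l / B))"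
  proof (rule sum_mono)
    fix l assume l: "l \<in> L"
    show "(a l / A) powr t * (b l / B) powr (1 - t) \<le> t * (a l / A) + (1 - t) * (b l / B)"
    proof (cases "a l = 0 \<or> b l = 0")
      case True
      then show ?thesis using a[OF l] b[OF l] AB t by auto
    next
      case False
      then show ?thesis
        using a[OF l] b[OF l] AB t by (intro Youngs_inequality_0) auto
    qed
  qed
  also have "\<dots> = t * (A / A) + (1 - t) * (B / B)"
    by (simp only: sum.distrib A_def B_def sum_distrib_left[symmetric] sum_divide_distrib[symmetric])
  also have "\<dots> = 1" using AB by simp
  finally have "(\<Sum>l\<in>L. (a l / A) powr t * (b l / B) powr (1 - t)) \<le> 1" .
  moreover have "(\<Sum>l\<in>L. (a l / A) powr t * (b l / B) powr (1 - t)) =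
      (\<Sum>l\<in>L. a l powr t * b l powr (1 - t)) / (A powr t * B powr (1 - t))"
    using AB by (simp add: powr_divide a b sum_divide_distrib)
  ultimately show ?thesis
    using AB by (simp add: field_simps flip: A_def B_def)
qed

section \<open>Two-point inequalities for finite l^p norms\<close>

definition lp_fin_norm :: "real \<Rightarrow> 'a set \<Rightarrow> ('a \<Rightarrow> real) \<Rightarrow> real" where
  "lp_fin_norm p L x = (\<Sum>l\<in>L. \<bar>x l\<bar> powr p) powr (1 / p)"

lemma lp_fin_norm_nonneg [simp]: "0 \<le> lp_fin_norm p L x"
  by (simp add: lp_fin_norm_def)

lemma lp_fin_norm_cong:
  "(\<And>l. l \<in> L \<Longrightarrow> x l = y l) \<Longrightarrow> lp_fin_norm p L x = lp_fin_norm p L y"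
  by (simp add: lp_fin_norm_def)

text \<open>The scalar inequality is used in each coordinate with its own bound \<open>w l\<close>,
  which gives a gain by the weighted square sum \<open>Q\<close>. Hoelder's inequality bounds the
  l^p norm of the difference by \<open>Q\<close> and \<open>S\<close>; raising to the power 2/p then
  gives squares of norms.\<close>

lemma lp_fin_norm_2_convex:
  fixes x y :: "'a \<Rightarrow> real"
  assumes L: "finite L" and p: "1 < p" "p \<le> 2"
  shows "(lp_fin_norm p L (\<lambda>l. (x l + y l) / 2))\<^sup>2 + p * (p - 1) / 16 * (lp_fin_norm p L (\<lambda>l. x l - y l))\<^sup>2
    \<le> ((lp_fin_norm p L x)\<^sup>2 + (lp_fin_norm p L y)\<^sup>2) / 2"
proof -
  define \<Sigma> where "\<Sigma> z = (\<Sum>l\<in>L. \<bar>z l\<bar> powr p)" for z :: "'a \<Rightarrow> real"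
  define m where "m l = (x l + y l) / 2" for l
  define d where "d l = x l - y l" for l
  define w where "w l = max \<bar>x l\<bar> \<bar>y l\<bar>" for l
  define Q where "Q = (\<Sum>l\<in>L. w l powr (p - 2) * (d l)\<^sup>2)"
  define S where "S = (\<Sigma> x + \<Sigma> y) / 2"
  define \<kappa> where "\<kappa> = p * (p - 1) / 8"
  have \<Sigma>0: "0 \<le> \<Sigma> z" for z by (simp add: \<Sigma>_def sum_nonneg)
  have Q0: "0 \<le> Q" by (simp add: Q_def sum_nonneg)
  have \<kappa>0: "0 \<le> \<kappa>" using p by (simp add: \<kappa>_def)
  have nrm: "(lp_fin_norm p L z)\<^sup>2 = \<Sigma> z powr (2 / p)" for z
  proof -
    have "(lp_fin_norm p L z)\<^sup>2 = \<Sigma> z powr (1 / p) * \<Sigma> z powr (1 / p)"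
      by (simp add: lp_fin_norm_def \<Sigma>_def power2_eq_square)
    then show ?thesis by (simp flip: powr_add)
  qed
  have pt: "\<bar>m l\<bar> powr p + \<kappa> * (w l powr (p - 2) * (d l)\<^sup>2) \<le> (\<bar>x l\<bar> powr p + \<bar>y l\<bar> powr p) / 2" for l
  proof (cases "w l = 0")
    case True
    then have "x l = 0" "y l = 0" by (auto simp: w_def max_def split: if_splits)
    then show ?thesis by (simp add: m_def d_def)
  next
    case False
    then have "0 < w l" by (auto simp: w_def less_max_iff_disj)
    from powr_midpoint_quadratic[OF p this, of "x l" "y l"] show ?thesis
      by (simp add: m_def d_def \<kappa>_def w_def mult.assoc)
  qed
  have 1: "\<Sigma> m + \<kappa> * Q \<le> S"
    using sum_mono[of L, OF pt] unfolding \<Sigma>_def Q_def S_def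
    by (simp add: sum.distrib sum_distrib_left sum_divide_distrib[symmetric])
  have W: "(\<Sum>l\<in>L. w l powr p) \<le> 2 * S"
  proof -
    have "(\<Sum>l\<in>L. w l powr p) \<le> (\<Sum>l\<in>L. \<bar>x l\<bar> powr p + \<bar>y l\<bar> powr p)"
      by (intro sum_mono) (auto simp: w_def max_def)
    then show ?thesis
      by (simp add: S_def \<Sigma>_def sum.distrib)
  qed
  have 2: "\<Sigma> d \<le> Q powr (p / 2) * (2 * S) powr (1 - p / 2)"
  proof -
    \<comment> \<open>The powers of \<open>w l\<close> in the two factors cancel, since (p - 2) p/2
      + p (1 - p/2) = 0.\<close>
    have "\<bar>d l\<bar> powr p = (w l powr (p - 2) * (d l)\<^sup>2) powr (p / 2) * (w l powr p) powr (1 - p / 2)" for l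
    proof (cases "w l = 0")
      case True
      then have "d l = 0" by (auto simp: w_def d_def max_def split: if_splits)
      then show ?thesis using p by simp
    next
      case False
      then have w: "0 < w l" by (auto simp: w_def less_max_iff_disj)
      have "(d l)\<^sup>2 powr (p / 2) = \<bar>d l\<bar> powr p"
      proof (cases "d l = 0")
        case False
        then have "(d l)\<^sup>2 powr (p / 2) = (\<bar>d l\<bar> powr 2) powr (p / 2)" by (simp add: powr_numeral)
        also have "\<dots> = \<bar>d l\<bar> powr p" by (simp only: powr_powr) simp
        finally show ?thesis .
      qed (use p in simp)
      moreover have "(w l powr (p - 2)) powr (p / 2) * (w l powr p) powr (1 - p / 2) = 1"
      proof -
        have "(p - 2) * (p / 2) + p * (1 - p / 2) = 0" by (simp add: field_simps)
        then show ?thesis using w by (simp add: powr_powr flip: powr_add)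
      qed
      ultimately show ?thesis
        using w by (simp add: powr_mult mult.commute mult.left_commute)
    qed
    then have "\<Sigma> d = (\<Sum>l\<in>L. (w l powr (p - 2) * (d l)\<^sup>2) powr (p / 2) * (w l powr p) powr (1 - p / 2))"
      by (simp add: \<Sigma>_def)
    also have "\<dots> \<le> Q powr (p / 2) * (\<Sum>l\<in>L. w l powr p) powr (1 - p / 2)"
      unfolding Q_def using p by (intro Holder_sum L) auto
    also have "\<dots> \<le> Q powr (p / 2) * (2 * S) powr (1 - p / 2)"
      using p W by (intro mult_left_mono powr_mono2) (auto simp: sum_nonneg)
    finally show ?thesis .
  qed
  have S0: "0 \<le> S" using \<Sigma>0 by (simp add: S_def)
  have 3: "\<Sigma> d powr (2 / p) \<le> 2 * (Q * S powr (2 / p - 1))"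
  proof -
    have "\<Sigma> d powr (2 / p) \<le> (Q powr (p / 2) * (2 * S) powr (1 - p / 2)) powr (2 / p)"
      using 2 \<Sigma>0 p by (intro powr_mono2) auto
    also have "\<dots> = Q * (2 * S) powr (2 / p - 1)"
    proof -
      have "(1 - p / 2) * (2 / p) = 2 / p - 1" using p by (simp add: field_simps)
      then show ?thesis using Q0 p by (simp add: powr_mult powr_powr)
    qed
    also have "(2 * S) powr (2 / p - 1) = 2 powr (2 / p - 1) * S powr (2 / p - 1)"
      using S0 by (simp add: powr_mult)
    \<comment> \<open>As 2/p - 1 \<le> 1, the constant is at most 2; this halves \<kappa> to p (p -
      1) / 16.\<close>
    also have "Q * (2 powr (2 / p - 1) * S powr (2 / p - 1)) \<le> Q * (2 powr 1 * S powr (2 / p - 1))"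
      using p Q0 by (intro mult_left_mono mult_right_mono powr_mono) (auto simp: field_simps)
    finally show ?thesis by (simp add: mult_ac)
  qed
  have 4: "\<Sigma> m powr (2 / p) + \<kappa> * (Q * S powr (2 / p - 1)) \<le> S powr (2 / p)"
  proof (cases "S = 0")
    case True
    with 1 \<Sigma>0[of m] Q0 \<kappa>0 have "\<Sigma> m = 0"
      by (smt (verit) mult_nonneg_nonneg)
    then show ?thesis using True p by simp
  next
    case False
    with S0 have S: "S > 0" by simp
    \<comment> \<open>\<open>z\<close> is the relative gain. It survives the power because 2/p \<ge>
      1 and 0 \<le> 1 - z \<le> 1, so that (1 - z)^(2/p) \<le> 1 - z.\<close>
    define z where "z = \<kappa> * Q / S"
    have Sz: "S * (1 - z) = S - \<kappa> * Q" using S by (simp add: z_def right_diff_distrib)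
    have z: "0 \<le> z" "z \<le> 1" "\<Sigma> m \<le> S * (1 - z)"
      using 1 \<Sigma>0[of m] \<kappa>0 Q0 S unfolding Sz by (auto simp: z_def)
    have "\<Sigma> m powr (2 / p) \<le> (S * (1 - z)) powr (2 / p)"
      using z \<Sigma>0 p by (intro powr_mono2) auto
    also have "\<dots> = S powr (2 / p) * (1 - z) powr (2 / p)"
      using S z by (simp add: powr_mult)
    also have "(1 - z) powr (2 / p) \<le> (1 - z) powr 1"
      using z p by (intro powr_mono') auto
    finally have "\<Sigma> m powr (2 / p) \<le> S powr (2 / p) * (1 - z)"
      using z by (simp add: mult_left_mono)
    moreover have "S powr (2 / p) * z = \<kappa> * (Q * S powr (2 / p - 1))"
      using S by (simp add: z_def powr_diff)
    ultimately show ?thesis by (simp add: algebra_simps)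
  qed
  have 5: "S powr (2 / p) \<le> (\<Sigma> x powr (2 / p) + \<Sigma> y powr (2 / p)) / 2"
    unfolding S_def using \<Sigma>0 p by (intro powr_midpoint) auto
  have "\<kappa> / 2 * \<Sigma> d powr (2 / p) \<le> \<kappa> * (Q * S powr (2 / p - 1))"
    using mult_left_mono[OF 3 \<kappa>0] by simp
  with 4 5 show ?thesis
    unfolding nrm m_def[abs_def, symmetric] d_def[abs_def, symmetric] by (simp add: \<kappa>_def)
qed

text \<open>The power q/2 \<ge> 1 is applied to the quadratic inequality: the left side splits by
  superadditivity, the right side by convexity of this power.\<close>

lemma lp_fin_norm_q_convex:
  fixes x y :: "'a \<Rightarrow> real"
  assumes L: "finite L" and p: "1 < p" "p \<le> 2" and q: "2 \<le> q"
  shows "lp_fin_norm p L (\<lambda>l. (x l + y l) / 2) powr q +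
      (p * (p - 1) / 16) powr (q / 2) * lp_fin_norm p L (\<lambda>l. x l - y l) powr q
    \<le> (lp_fin_norm p L x powr q + lp_fin_norm p L y powr q) / 2"
proof -
  have sq: "z powr q = (z\<^sup>2) powr (q / 2)" if "0 \<le> z" for z :: real
  proof (cases "z = 0")
    case False
    with that have "z\<^sup>2 = z powr 2" by (simp add: powr_numeral)
    then show ?thesis by (simp add: powr_powr)
  qed (use q in simp)
  let ?m = "lp_fin_norm p L (\<lambda>l. (x l + y l) / 2)" and ?d = "lp_fin_norm p L (\<lambda>l. x l - y l)"
  let ?x = "lp_fin_norm p L x" and ?y = "lp_fin_norm p L y"
  define c where "c = p * (p - 1) / 16"
  have c: "0 \<le> c" using p by (simp add: c_def)
  have "?m powr q + c powr (q / 2) * ?d powr q = (?m\<^sup>2) powr (q / 2) + (c * ?d\<^sup>2) powr (q / 2)"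
    using c by (simp add: sq powr_mult)
  also have "\<dots> \<le> (?m\<^sup>2 + c * ?d\<^sup>2) powr (q / 2)"
    using c q by (intro powr_superadditive) auto
  also have "\<dots> \<le> ((?x\<^sup>2 + ?y\<^sup>2) / 2) powr (q / 2)"
    using c q by (intro powr_mono2 lp_fin_norm_2_convex[OF L p, folded c_def]) auto
  also have "\<dots> \<le> ((?x\<^sup>2) powr (q / 2) + (?y\<^sup>2) powr (q / 2)) / 2"
    using q by (intro powr_midpoint) auto
  finally show ?thesis by (simp add: sq c_def)
qed

section \<open>Tikhonov regularization\<close>

lemma pairing_summands_lincomb:
  assumes "continuous_on UNIV w"
  shows "pairing_summands \<eta> (\<lambda>\<phi>. a * u \<phi> + b * v \<phi>) w n =
    a * pairing_summands \<eta> u w n + b * pairing_summands \<eta> v w n"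
proof -
  have "lp_block \<eta> n (\<lambda>\<phi>. a * u \<phi> + b * v \<phi>) x = of_real a * lp_block \<eta> n u x + of_real b * lp_block \<eta> n v x" for x
    using lp_block_add[of \<eta> n "\<lambda>\<phi>. a * u \<phi>" "\<lambda>\<phi>. b * v \<phi>"] by (simp add: lp_block_cmult)
  then have "pairing_summands \<eta> (\<lambda>\<phi>. a * u \<phi> + b * v \<phi>) w n =
      L2_inner w (\<lambda>x. a * Re (lp_block \<eta> n u x) + b * Re (lp_block \<eta> n v x))"
    by (simp add: pairing_summands_def L2_inner_commute)
  also have "\<dots> = a * L2_inner w (\<lambda>x. Re (lp_block \<eta> n u x)) + b * L2_inner w (\<lambda>x. Re (lp_block \<eta> n v x))"
    by (subst L2_inner_continuous_add)
      (auto intro!: continuous_intros continuous_on_lp_block assms)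
  finally show ?thesis by (simp add: pairing_summands_def L2_inner_commute)
qed

text \<open>\<open>suminf\<close> is linear on convergent series only;
  \<open>generates_besov\<close> supplies the convergence.\<close>

lemma pairing_lincomb:
  assumes "continuous_on UNIV w" "summable (pairing_summands \<eta> u w)" "summable (pairing_summands \<eta> v w)"
  shows "pairing \<eta> (\<lambda>\<phi>. a * u \<phi> + b * v \<phi>) w = a * pairing \<eta> u w + b * pairing \<eta> v w"
  unfolding pairing_def pairing_summands_lincomb[OF assms(1)]
  using assms by (simp add: suminf_add[symmetric] suminf_mult summable_mult)

text \<open>With \<open>r = q \<ge> 2\<close> the \<open>r\<close>-th power of the wavelet norm is a weighted sum of \<open>r\<close>-th powers of
  \<open>l\<^sup>p\<close> norms, so that it inherits their uniform convexity.\<close>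

lemma wavelet_norm_uniformly_convex:
  fixes \<eta> :: "real^'d \<Rightarrow> real" and W :: "nat \<Rightarrow> 'l \<Rightarrow> real^'d \<Rightarrow> real"
  assumes p: "1 < p" "p \<le> 2" and r: "2 \<le> r"
    and W: "orthonormal_system I W" and gen: "generates_besov \<eta> I W 0 p (ereal r)"
    and u: "u \<in> besov_space \<eta> 0 p (ereal r)" and v: "v \<in> besov_space \<eta> 0 p (ereal r)"
  shows "wavelet_norm \<eta> I W 0 p (ereal r) (\<lambda>\<phi>. 1/2 * u \<phi> + 1/2 * v \<phi>) powr r +
      (p * (p - 1) / 16) powr (r / 2) * wavelet_norm \<eta> I W 0 p (ereal r) (u - v) powr r
    \<le> (wavelet_norm \<eta> I W 0 p (ereal r) u powr r + wavelet_norm \<eta> I W 0 p (ereal r) v powr r) / 2"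
proof -
  let ?V = "besov_space \<eta> 0 p (ereal r)"
  let ?m = "\<lambda>\<phi>. 1/2 * u \<phi> + 1/2 * v \<phi>"
  let ?c = "(p * (p - 1) / 16) powr (r / 2)"
  define \<omega> where "\<omega> j = 2 powr (real j * (0 + real CARD('d) * (1/2 - 1/p)))" for j
  define a where "a u j = lp_fin_norm p (I j) (\<lambda>l. pairing \<eta> u (W j l))" for u j
  have fin: "finite (I j)" for j
    using W by (simp add: orthonormal_system_def)
  have cont: "continuous_on UNIV (W j l)" if "l \<in> I j" for j l
    using W that by (simp add: orthonormal_system_def)
  have summ: "summable (pairing_summands \<eta> u (W j l))" if "u \<in> ?V" "l \<in> I j" for u j l
    using gen that by (simp add: generates_besov_def)
  have pq: "1 \<le> p" "1 \<le> ereal r" using p r by auto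
  have m: "?m \<in> ?V"
    using besov_space_add[OF pq besov_space_cmult[OF pq u] besov_space_cmult[OF pq v]] .
  have d: "u - v \<in> ?V" by (rule besov_space_diff[OF pq u v])
  have seq: "wavelet_seq \<eta> I W 0 p u j = \<omega> j * a u j" for u j
    by (simp add: wavelet_seq_def \<omega>_def a_def lp_fin_norm_def)
  have a0: "0 \<le> \<omega> j * a u j" for u j by (simp add: \<omega>_def a_def)
  have sm: "summable (\<lambda>j. (\<omega> j * a u j) powr r)" if "u \<in> ?V" for u
  proof -
    have "lq_mem (ereal r) (wavelet_seq \<eta> I W 0 p u)"
      using gen that unfolding generates_besov_def by blast
    then have "summable (\<lambda>j. \<bar>\<omega> j * a u j\<bar> powr r)"
      by (simp only: lq_mem_def seq) simp
    then show ?thesis by (simp only: abs_of_nonneg[OF a0])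
  qed
  have norm: "wavelet_norm \<eta> I W 0 p (ereal r) u powr r = (\<Sum>j. (\<omega> j * a u j) powr r)" if "u \<in> ?V" for u
    using r a0[of _ u] suminf_nonneg[OF sm[OF that]]
    by (simp add: wavelet_norm_def lq_norm_def seq powr_powr)
  have "(\<omega> j * a ?m j) powr r + ?c * (\<omega> j * a (u - v) j) powr r
      \<le> ((\<omega> j * a u j) powr r + (\<omega> j * a v j) powr r) / 2" for j
  proof -
    have "pairing \<eta> ?m (W j l) = (pairing \<eta> u (W j l) + pairing \<eta> v (W j l)) / 2"
      "pairing \<eta> (u - v) (W j l) = pairing \<eta> u (W j l) - pairing \<eta> v (W j l)" if "l \<in> I j" for l
      using pairing_lincomb[OF cont[OF that] summ[OF u that] summ[OF v that], of "1/2" "1/2"]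
        pairing_lincomb[OF cont[OF that] summ[OF u that] summ[OF v that], of 1 "- 1"]
      by (simp_all add: fun_diff_def add_divide_distrib)
    then have "a ?m j = lp_fin_norm p (I j) (\<lambda>l. (pairing \<eta> u (W j l) + pairing \<eta> v (W j l)) / 2)"
      "a (u - v) j = lp_fin_norm p (I j) (\<lambda>l. pairing \<eta> u (W j l) - pairing \<eta> v (W j l))"
      unfolding a_def by (auto intro!: lp_fin_norm_cong)
    with lp_fin_norm_q_convex[OF fin p r, of j "\<lambda>l. pairing \<eta> u (W j l)" "\<lambda>l. pairing \<eta> v (W j l)"]
    have "a ?m j powr r + ?c * a (u - v) j powr r \<le> (a u j powr r + a v j powr r) / 2"
      by (simp add: a_def)
    from mult_left_mono[OF this, of "\<omega> j powr r"] show ?thesis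
      by (simp add: powr_mult \<omega>_def a_def algebra_simps)
  qed
  then have "(\<Sum>j. (\<omega> j * a ?m j) powr r + ?c * (\<omega> j * a (u - v) j) powr r)
      \<le> (\<Sum>j. ((\<omega> j * a u j) powr r + (\<omega> j * a v j) powr r) / 2)"
    by (intro suminf_le summable_add summable_mult summable_divide sm m d u v)
  also have "(\<Sum>j. (\<omega> j * a ?m j) powr r + ?c * (\<omega> j * a (u - v) j) powr r) =
      (\<Sum>j. (\<omega> j * a ?m j) powr r) + ?c * (\<Sum>j. (\<omega> j * a (u - v) j) powr r)"
    using suminf_add[OF sm[OF m] summable_mult[OF sm[OF d], of ?c]]
    by (simp only: suminf_mult[OF sm[OF d]])
  also have "(\<Sum>j. ((\<omega> j * a u j) powr r + (\<omega> j * a v j) powr r) / 2) =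
      ((\<Sum>j. (\<omega> j * a u j) powr r) + (\<Sum>j. (\<omega> j * a v j) powr r)) / 2"
    by (subst suminf_add[OF sm[OF u] sm[OF v]])
      (rule suminf_divide[OF summable_add[OF sm[OF u] sm[OF v]]])
  finally show ?thesis
    by (simp only: norm[OF m] norm[OF d] norm[OF u] norm[OF v])
qed

text \<open>The subgradient inequality is tested at the midpoint, where it reads P(m) \<ge> P(v) +
  F(u - v)/2. Combined with the midpoint gain \<open>e\<close> this bounds half of the Bregman
  distance from below, hence the factor 2.\<close>

lemma bregman_lower_bound:
  fixes V :: "'d::finite distribution set"
  assumes sub: "subgradient V N P v F" and u: "u \<in> V" and v: "v \<in> V"
    and V: "\<And>u v. u \<in> V \<Longrightarrow> v \<in> V \<Longrightarrow> u - v \<in> V" "\<And>u c. u \<in> V \<Longrightarrow> (\<lambda>\<phi>. c * u \<phi>) \<in> V"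
    and m: "(\<lambda>\<phi>. 1/2 * u \<phi> + 1/2 * v \<phi>) \<in> V"
    and conv: "P (\<lambda>\<phi>. 1/2 * u \<phi> + 1/2 * v \<phi>) + e \<le> (P u + P v) / 2"
  shows "2 * e \<le> bregman P F u v"
proof -
  have "(\<lambda>\<phi>. 1/2 * u \<phi> + 1/2 * v \<phi>) - v = (\<lambda>\<phi>. 1/2 * (u - v) \<phi>)"
    by (auto simp: fun_eq_iff field_simps)
  moreover have "F (\<lambda>\<phi>. 1/2 * (u - v) \<phi>) = 1/2 * F (u - v)"
    using sub V(1)[OF u v] unfolding subgradient_def by blast
  moreover have "P (\<lambda>\<phi>. 1/2 * u \<phi> + 1/2 * v \<phi>) \<ge> P v + F ((\<lambda>\<phi>. 1/2 * u \<phi> + 1/2 * v \<phi>) - v)"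
    using sub m unfolding subgradient_def by blast
  ultimately have "P v + 1/2 * F (u - v) + e \<le> (P u + P v) / 2"
    using conv by simp
  then show ?thesis by (simp add: bregman_def field_simps)
qed

section \<open>From minimality and the source condition to the rate\<close>

lemma heat_operator_continuous:
  assumes "heat_operator tbar V T" "f \<in> V" "tbar > 0"
  shows "continuous_on UNIV (T f)"
proof -
  obtain u where u: "heat_solution tbar f u" "T f = u tbar"
    using assms unfolding heat_operator_def by blast
  then have "continuous_on ({0<..tbar} \<times> UNIV) (\<lambda>(t, x). u t x)"
    by (simp add: heat_solution_def)
  from continuous_on_slice[OF this, of tbar] assms(3) u(2) show ?thesis by simp
qed

lemma L2_fun_integrable_mult:
  assumes g: "L2_fun g" and h: "continuous_on UNIV h"
  shows "integrable torus (\<lambda>x. g x * h x)"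
proof (rule Bochner_Integration.integrable_bound)
  have h': "h \<in> borel_measurable torus"
    using integrable_torus[OF h] by blast
  have g': "g \<in> borel_measurable torus"
    using g unfolding L2_fun_def torus_def by (intro measurable_restrict_space1) auto
  show "(\<lambda>x. g x * h x) \<in> borel_measurable torus"
    using g' h' by (rule borel_measurable_times)
  show "integrable torus (\<lambda>x. (g x)\<^sup>2 + (h x)\<^sup>2)"
  proof (rule Bochner_Integration.integrable_add)
    show "integrable torus (\<lambda>x. (g x)\<^sup>2)" using g by (simp add: L2_fun_def)
    show "integrable torus (\<lambda>x. (h x)\<^sup>2)" by (intro integrable_torus continuous_intros h)
  qed
  have "\<bar>g x * h x\<bar> \<le> (g x)\<^sup>2 + (h x)\<^sup>2" for x
  proof -
    have "2 * (\<bar>g x\<bar> * \<bar>h x\<bar>) \<le> (g x)\<^sup>2 + (h x)\<^sup>2"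
      using zero_le_power2[of "\<bar>g x\<bar> - \<bar>h x\<bar>"] by (simp add: power2_diff)
    moreover have "0 \<le> \<bar>g x\<bar> * \<bar>h x\<bar>" by simp
    ultimately show ?thesis unfolding abs_mult by linarith
  qed
  then show "AE x in torus. norm (g x * h x) \<le> norm ((g x)\<^sup>2 + (h x)\<^sup>2)"
    by simp
qed

text \<open>The minimality of \<open>fhat\<close> and the source condition bound the Bregman distance by
  \<open>2 * \<delta>\<^sup>2 / \<alpha> + 2 * (\<psi> \<tau> - \<tau> / (4 * \<alpha>))\<close>, where \<open>\<tau>\<close> is the squared residual; the choice of
  \<open>\<alpha>\<close> says that \<open>4 * \<delta>\<^sup>2\<close> maximizes the second summand over \<open>\<tau> \<ge> 0\<close>.\<close>

lemma tikhonov_bregman_bound: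
  fixes T :: "'d::finite distribution \<Rightarrow> real^'d \<Rightarrow> real"
  assumes cont: "\<And>f. f \<in> D \<Longrightarrow> continuous_on UNIV (T f)" and fdag: "fdag \<in> D"
    and g: "L2_fun g" "Lp_norm 2 (g - T fdag) \<le> \<delta>"
    and Fdiff: "F (fdag - fhat) = - F (fhat - fdag)"
    and src: "source_condition D T P \<psi> fdag F" and \<alpha>: "\<alpha> > 0"
    and sub: "- 1 / (4 * \<alpha>) \<in> subdifferential (\<lambda>\<tau>. - \<psi> \<tau>) (4 * \<delta>\<^sup>2)"
    and min: "tikhonov_minimizer D T P \<alpha> g fhat"
  shows "bregman P F fhat fdag \<le> 2 * \<psi> (4 * \<delta>\<^sup>2)"
proof -
  have fhat: "fhat \<in> D" using min by (simp add: tikhonov_minimizer_def is_arg_min_def)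
  define A where "A = T fdag"
  define B where "B = T fhat"
  define h where "h x = B x - A x" for x
  define \<xi> where "\<xi> x = g x - A x" for x
  have cA: "continuous_on UNIV A" and cB: "continuous_on UNIV B"
    unfolding A_def B_def by (intro cont fdag fhat)+
  have ch: "continuous_on UNIV h" unfolding h_def by (intro continuous_intros cA cB)
  have iA: "integrable torus (\<lambda>x. (A x)\<^sup>2)" "integrable torus (\<lambda>x. (B x)\<^sup>2)"
    "integrable torus (\<lambda>x. (h x)\<^sup>2)" "integrable torus (\<lambda>x. A x * B x)"
    by (intro integrable_torus continuous_intros cA cB ch)+
  have ig: "integrable torus (\<lambda>x. g x * A x)" "integrable torus (\<lambda>x. g x * B x)"
    by (intro L2_fun_integrable_mult g cA cB)+
  have ig2: "integrable torus (\<lambda>x. (g x)\<^sup>2)" using g(1) by (simp add: L2_fun_def)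
  have i\<xi>: "integrable torus (\<lambda>x. (\<xi> x)\<^sup>2)"
  proof -
    have "integrable torus (\<lambda>x. (g x)\<^sup>2 - 2 * (g x * A x) + (A x)\<^sup>2)"
      by (intro Bochner_Integration.integrable_add Bochner_Integration.integrable_diff
          integrable_mult_right ig ig2 iA)
    then show ?thesis by (simp add: \<xi>_def power2_diff mult.assoc algebra_simps)
  qed
  have N2: "(Lp_norm 2 f)\<^sup>2 = (LINT x|torus. (f x)\<^sup>2)" for f :: "real^'d \<Rightarrow> real"
    by (simp add: Lp_norm_2_eq)
  define \<tau> where "\<tau> = (LINT x|torus. (h x)\<^sup>2)"
  have \<tau>0: "0 \<le> \<tau>" by (simp add: \<tau>_def)
  have \<tau>: "(Lp_norm 2 (T fdag - T fhat))\<^sup>2 = \<tau>"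
    unfolding N2 \<tau>_def by (simp add: h_def A_def B_def fun_diff_def power2_commute)
  have \<delta>: "(LINT x|torus. (\<xi> x)\<^sup>2) \<le> \<delta>\<^sup>2"
  proof -
    have "(Lp_norm 2 (g - T fdag))\<^sup>2 \<le> \<delta>\<^sup>2"
      using g(2) by (intro power_mono) auto
    then show ?thesis by (simp add: N2 \<xi>_def A_def fun_diff_def)
  qed
  have "tikhonov_functional T P \<alpha> g fhat \<le> tikhonov_functional T P \<alpha> g fdag"
    using min fdag unfolding tikhonov_minimizer_def is_arg_min_def by force
  then have 1: "\<alpha> * (P fhat - P fdag) \<le> 1/2 * (LINT x|torus. (A x)\<^sup>2) - (LINT x|torus. g x * A x)
      - 1/2 * (LINT x|torus. (B x)\<^sup>2) + (LINT x|torus. g x * B x)"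
    unfolding tikhonov_functional_def N2 L2_inner_def A_def B_def by (simp add: algebra_simps)
  also have "\<dots> = (LINT x|torus. 1/2 * (A x)\<^sup>2 - g x * A x - 1/2 * (B x)\<^sup>2 + g x * B x)"
    using iA ig by simp
  \<comment> \<open>Pointwise the left side is \<open>\<xi> * h - 1/2 * h\<^sup>2\<close>. Young's
    inequality with \<open>\<xi>\<^sup>2 + 1/4 * h\<^sup>2\<close> leaves
    \<open>- 1/4 * h\<^sup>2\<close>, which matches the slope \<open>- 1 / (4 * \<alpha>)\<close> in
    the choice of \<alpha>.\<close>
  also have "\<dots> \<le> (LINT x|torus. (\<xi> x)\<^sup>2 - 1/4 * (h x)\<^sup>2)"
  proof (rule integral_mono)
    fix x
    have "1/2 * (A x)\<^sup>2 - g x * A x - 1/2 * (B x)\<^sup>2 + g x * B x = \<xi> x * h x - 1/2 * (h x)\<^sup>2"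
      by (simp add: \<xi>_def h_def power2_eq_square algebra_simps)
    moreover have "\<xi> x * h x \<le> (\<xi> x)\<^sup>2 + 1/4 * (h x)\<^sup>2"
      using zero_le_power2[of "\<xi> x - h x / 2"] by (simp add: power2_eq_square algebra_simps)
    ultimately show "1/2 * (A x)\<^sup>2 - g x * A x - 1/2 * (B x)\<^sup>2 + g x * B x \<le> (\<xi> x)\<^sup>2 - 1/4 * (h x)\<^sup>2"
      by linarith
  qed (intro Bochner_Integration.integrable_add Bochner_Integration.integrable_diff
      integrable_mult_right iA ig i\<xi>)+
  also have "\<dots> = (LINT x|torus. (\<xi> x)\<^sup>2) - 1/4 * \<tau>"
    using iA i\<xi> by (simp add: \<tau>_def)
  also have "\<dots> \<le> \<delta>\<^sup>2 - 1/4 * \<tau>" using \<delta> by simp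
  finally have "P fhat - P fdag \<le> (\<delta>\<^sup>2 - 1/4 * \<tau>) / \<alpha>"
    using \<alpha> by (simp add: pos_le_divide_eq mult.commute)
  then have "bregman P F fhat fdag + F (fhat - fdag) \<le> \<delta>\<^sup>2 / \<alpha> - \<tau> / (4 * \<alpha>)"
    by (simp add: bregman_def diff_divide_distrib)
  moreover have "- F (fhat - fdag) \<le> 1/2 * bregman P F fhat fdag + \<psi> \<tau>"
    using src fhat unfolding source_condition_def \<tau>[symmetric] Fdiff[symmetric] by blast
  \<comment> \<open>The supporting line at \<open>4 * \<delta>\<^sup>2\<close> cancels both
    \<open>\<delta>\<^sup>2 / \<alpha>\<close> and \<open>\<tau> / (4 * \<alpha>)\<close>; what
    remains is half the Bregman distance, at most
    \<open>\<psi> (4 * \<delta>\<^sup>2)\<close>.\<close>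
  moreover have "- \<psi> \<tau> \<ge> - \<psi> (4 * \<delta>\<^sup>2) + - 1 / (4 * \<alpha>) * (\<tau> - 4 * \<delta>\<^sup>2)"
    using sub \<tau>0 unfolding subdifferential_def by blast
  then have "\<psi> \<tau> \<le> \<psi> (4 * \<delta>\<^sup>2) + \<tau> / (4 * \<alpha>) - \<delta>\<^sup>2 / \<alpha>"
    by (simp add: right_diff_distrib)
  ultimately show ?thesis by linarith
qed

text \<open>With q = r the logarithmic exponent is e = sr/2. Put x = \<rho>/\<delta>. The first
  summand decays like x^(-1/2), faster than any power of the logarithm, where x \<ge> 6 gives 3 +
  x/2 \<le> x. For the second, (3 + x/2)^2 \<ge> x shows that the inner logarithm is at least (ln
  x)/4.\<close>

lemma index_fun_le_log:
  assumes \<rho>: "\<rho> > 0" and \<delta>: "\<delta> > 0" "6 * \<delta> \<le> \<rho>" and c0: "c0 > 0" and s: "s > 0" and r: "r \<ge> 2"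
  shows "index_fun c0 \<rho> s r r (4 * \<delta>\<^sup>2) \<le>
    c0 * \<rho> powr r * ((2 * (s * r) powr (s * r / 2) + 4 powr (s * r / 2)) * ln (\<rho> / \<delta>) powr (- (s * r / 2)))"
proof -
  define x where "x = \<rho> / \<delta>"
  define e where "e = s * r / 2"
  have x: "x \<ge> 6" using \<delta> by (simp add: x_def field_simps)
  have e: "e > 0" using s r by (simp add: e_def)
  have lnx: "ln x > 0" using x by simp
  have sq: "sqrt (4 * \<delta>\<^sup>2) = 2 * \<delta>" using \<delta> by (simp add: real_sqrt_mult)
  have ex: "- (s * (r - 1) * (r / (r - 1)) / 2) = - e" using r by (simp add: e_def)
  have x_eq: "2 * \<delta> / \<rho> = 2 / x" "\<rho> / (2 * \<delta>) = x / 2" by (simp_all add: x_def)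
  have "4 * \<delta>\<^sup>2 \<noteq> 0" using \<delta> by simp
  then have idx: "index_fun c0 \<rho> s r r (4 * \<delta>\<^sup>2) =
      c0 * \<rho> powr r * (2 / x * (3 + x / 2) powr (1/2) + ln ((3 + x / 2) powr (1/2)) powr (- e))"
    unfolding index_fun_def sq ex x_eq by (simp only: if_False)
  \<comment> \<open>\<open>ln_powr_bound2\<close> with exponent \<open>2 * e\<close>, followed by a
    square root, bounds (ln x)^e by (2e)^e x^(1/2).\<close>
  have "2 / x * (3 + x / 2) powr (1/2) \<le> 2 * (2 * e) powr e * ln x powr (- e)"
  proof -
    have "ln x powr e = (ln x powr (2 * e)) powr (1/2)"
      by (simp add: powr_powr)
    also have "\<dots> \<le> ((2 * e) powr (2 * e) * x) powr (1/2)"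
      using x e by (intro powr_mono2 ln_powr_bound2) auto
    also have "\<dots> = (2 * e) powr e * x powr (1/2)"
      using x e by (simp add: powr_mult powr_powr)
    finally have "1 \<le> (2 * e) powr e * x powr (1/2) * ln x powr (- e)"
      using lnx by (simp add: powr_minus field_simps)
    then have "2 / x * x powr (1/2) * 1 \<le> 2 / x * x powr (1/2) * ((2 * e) powr e * x powr (1/2) * ln x powr (- e))"
      using x by (intro mult_left_mono) auto
    also have "\<dots> = 2 / x * (x powr (1/2) * x powr (1/2)) * ((2 * e) powr e * ln x powr (- e))"
      by (simp add: mult_ac)
    also have "x powr (1/2) * x powr (1/2) = x" using x by (simp flip: powr_add)
    finally have "2 / x * x powr (1/2) \<le> 2 * ((2 * e) powr e * ln x powr (- e))"
      using x by simp
    moreover have "2 / x * (3 + x / 2) powr (1/2) \<le> 2 / x * x powr (1/2)"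
      using x by (intro mult_left_mono powr_mono2) auto
    ultimately show ?thesis by (simp add: mult.assoc)
  qed
  moreover have "ln ((3 + x / 2) powr (1/2)) powr (- e) \<le> 4 powr e * ln x powr (- e)"
  proof -
    have "(x / 2 + 3)\<^sup>2 \<ge> x"
      using x by (simp add: power2_eq_square field_simps)
    then have "ln x \<le> ln ((x / 2 + 3)\<^sup>2)" using x by simp
    also have "\<dots> = 2 * ln (3 + x / 2)" using x by (simp add: ln_realpow add.commute)
    finally have "ln x / 4 \<le> ln ((3 + x / 2) powr (1/2))"
      using x by simp
    then have "ln ((3 + x / 2) powr (1/2)) powr (- e) \<le> (ln x / 4) powr (- e)"
      using lnx e by (intro powr_mono2') auto
    also have "\<dots> = 4 powr e * ln x powr (- e)"
      using lnx by (simp add: powr_divide powr_minus field_simps)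
    finally show ?thesis .
  qed
  ultimately have "2 / x * (3 + x / 2) powr (1/2) + ln ((3 + x / 2) powr (1/2)) powr (- e)
      \<le> (2 * (2 * e) powr e + 4 powr e) * ln x powr (- e)"
    by (simp add: distrib_right)
  then have "c0 * \<rho> powr r * (2 / x * (3 + x / 2) powr (1/2) + ln ((3 + x / 2) powr (1/2)) powr (- e))
      \<le> c0 * \<rho> powr r * ((2 * (2 * e) powr e + 4 powr e) * ln x powr (- e))"
    using c0 by (intro mult_left_mono) auto
  then show ?thesis unfolding idx by (simp add: e_def x_def)
qed

lemma tikhonov_rate:
  fixes \<eta> :: "real^'d \<Rightarrow> real" and N0 :: "'d distribution \<Rightarrow> real" and W :: "nat \<Rightarrow> 'l \<Rightarrow> real^'d \<Rightarrow> real"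
  assumes tbar: "tbar > 0" and p: "1 < p" "p \<le> 2" and r: "2 \<le> r" and s: "s > 0"
    and N0: "equivalent_besov_norm \<eta> 0 p (ereal r) N0"
    and T: "heat_operator tbar (besov_space \<eta> 0 p (ereal r)) T"
    and W: "orthonormal_system I W" and gen: "generates_besov \<eta> I W 0 p (ereal r)"
    and D: "D \<subseteq> besov_space \<eta> 0 p (ereal r)" and c0: "c0 > 0"
    and P: "P = penalty (wavelet_norm \<eta> I W 0 p (ereal r)) r"
  shows "\<exists>c>0. \<forall>\<rho>>0. \<forall>\<^sub>F \<delta> in at_right 0. \<forall>fdag gobs F \<alpha> fhat.
    fdag \<in> D \<and> L2_fun gobs \<and> Lp_norm 2 (gobs - T fdag) \<le> \<delta> \<and>
    subgradient (besov_space \<eta> 0 p (ereal r)) N0 P fdag F \<and>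
    source_condition D T P (index_fun c0 \<rho> s r r) fdag F \<and> \<alpha> > 0 \<and>
    - 1 / (4 * \<alpha>) \<in> subdifferential (\<lambda>\<tau>. - index_fun c0 \<rho> s r r \<tau>) (4 * \<delta>\<^sup>2) \<and>
    tikhonov_minimizer D T P \<alpha> gobs fhat \<longrightarrow> N0 (fhat - fdag) \<le> c * log_rate s \<rho> \<delta>"
proof -
  let ?V = "besov_space \<eta> 0 p (ereal r)"
  let ?N = "wavelet_norm \<eta> I W 0 p (ereal r)"
  have pq: "1 \<le> p" "1 \<le> ereal r" using p r by auto
  from N0 obtain b where b: "b > 0" "\<And>u. u \<in> ?V \<Longrightarrow> N0 u \<le> b * besov_norm \<eta> 0 p (ereal r) u"
    unfolding equivalent_besov_norm_def by blast
  from gen obtain a where a: "a > 0" "\<And>u. u \<in> ?V \<Longrightarrow> a * besov_norm \<eta> 0 p (ereal r) u \<le> ?N u"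
    unfolding generates_besov_def equivalent_besov_norm_def by blast
  define c1 where "c1 = (p * (p - 1) / 16) powr (r / 2)"
  define K where "K = 2 * (s * r) powr (s * r / 2) + 4 powr (s * r / 2)"
  \<comment> \<open>\<open>c1 / r\<close> is the convexity constant of the penalty and
    \<open>c0 * K\<close> the constant in the bound on the index function; the root passes from the
    r-th power of the error to the error.\<close>
  define C where "C = (r / c1 * (c0 * K)) powr (1 / r)"
  have c1: "c1 > 0" using p by (simp add: c1_def)
  have K: "K > 0" by (simp add: K_def add_nonneg_pos)
  have C: "C > 0" using c1 K c0 r by (simp add: C_def)
  have rate: "N0 (fhat - fdag) \<le> b / a * C * log_rate s \<rho> \<delta>"
    if \<rho>: "\<rho> > 0" and \<delta>: "\<delta> > 0" "6 * \<delta> \<le> \<rho>"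
      and fdag: "fdag \<in> D" and g: "L2_fun gobs" "Lp_norm 2 (gobs - T fdag) \<le> \<delta>"
      and F: "subgradient ?V N0 P fdag F"
      and src: "source_condition D T P (index_fun c0 \<rho> s r r) fdag F" and \<alpha>: "\<alpha> > 0"
      and sub: "- 1 / (4 * \<alpha>) \<in> subdifferential (\<lambda>\<tau>. - index_fun c0 \<rho> s r r \<tau>) (4 * \<delta>\<^sup>2)"
      and min: "tikhonov_minimizer D T P \<alpha> gobs fhat"
    for \<rho> \<delta> fdag gobs F \<alpha> fhat
  proof -
    have fhat: "fhat \<in> D" using min by (simp add: tikhonov_minimizer_def is_arg_min_def)
    have V: "fdag \<in> ?V" "fhat \<in> ?V" using fdag fhat D by auto
    have d: "fhat - fdag \<in> ?V" by (rule besov_space_diff[OF pq V(2,1)])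
    have L: "ln (\<rho> / \<delta>) > 0" using \<delta> by simp
    have "F (\<lambda>\<phi>. (- 1) * (fhat - fdag) \<phi>) = (- 1) * F (fhat - fdag)"
      using F d unfolding subgradient_def by blast
    moreover have "(\<lambda>\<phi>. (- 1) * (fhat - fdag) \<phi>) = fdag - fhat" by auto
    ultimately have Fdiff: "F (fdag - fhat) = - F (fhat - fdag)" by simp
    have cont: "continuous_on UNIV (T f)" if "f \<in> D" for f
      using heat_operator_continuous[OF T _ tbar] that D by blast
    have upper: "bregman P F fhat fdag \<le> 2 * index_fun c0 \<rho> s r r (4 * \<delta>\<^sup>2)"
      by (rule tikhonov_bregman_bound[OF cont fdag g Fdiff src \<alpha> sub min])
    have "2 * (c1 / r * ?N (fhat - fdag) powr r) \<le> bregman P F fhat fdag"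
    proof (rule bregman_lower_bound[OF F V(2,1)])
      show "(\<lambda>\<phi>. 1/2 * fhat \<phi> + 1/2 * fdag \<phi>) \<in> ?V"
        using besov_space_add[OF pq besov_space_cmult[OF pq V(2)] besov_space_cmult[OF pq V(1)]] .
      have "1 / r * (?N (\<lambda>\<phi>. 1/2 * fhat \<phi> + 1/2 * fdag \<phi>) powr r + c1 * ?N (fhat - fdag) powr r)
          \<le> 1 / r * ((?N fhat powr r + ?N fdag powr r) / 2)"
        unfolding c1_def using r
        by (intro mult_left_mono wavelet_norm_uniformly_convex[OF p r W gen V(2,1)]) auto
      then show "P (\<lambda>\<phi>. 1/2 * fhat \<phi> + 1/2 * fdag \<phi>) + c1 / r * ?N (fhat - fdag) powr r
          \<le> (P fhat + P fdag) / 2"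
        by (simp only: P penalty_def) (simp add: distrib_left add_divide_distrib)
    qed (use pq in \<open>auto intro: besov_space_diff besov_space_cmult\<close>)
    with upper have "c1 / r * ?N (fhat - fdag) powr r \<le> index_fun c0 \<rho> s r r (4 * \<delta>\<^sup>2)"
      by linarith
    also have "\<dots> \<le> c0 * \<rho> powr r * (K * ln (\<rho> / \<delta>) powr (- (s * r / 2)))"
      unfolding K_def by (rule index_fun_le_log[OF \<rho> \<delta> c0 s r])
    finally have "?N (fhat - fdag) powr r \<le> r / c1 * (c0 * \<rho> powr r * (K * ln (\<rho> / \<delta>) powr (- (s * r / 2))))"
      using c1 r by (simp add: field_simps)
    also have "\<dots> = r / c1 * (c0 * K) * (\<rho> powr r * ln (\<rho> / \<delta>) powr (- (s * r / 2)))"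
      by simp
    finally have "(?N (fhat - fdag) powr r) powr (1 / r) \<le>
        (r / c1 * (c0 * K) * (\<rho> powr r * ln (\<rho> / \<delta>) powr (- (s * r / 2)))) powr (1 / r)"
      using r by (intro powr_mono2) auto
    also have "\<dots> = C * (\<rho> powr r * ln (\<rho> / \<delta>) powr (- (s * r / 2))) powr (1 / r)"
      unfolding C_def by (rule powr_mult)
    also have "(\<rho> powr r * ln (\<rho> / \<delta>) powr (- (s * r / 2))) powr (1 / r) = log_rate s \<rho> \<delta>"
      using r \<rho> L by (simp add: powr_mult powr_powr log_rate_def)
    finally have bound: "(?N (fhat - fdag) powr r) powr (1 / r) \<le> C * log_rate s \<rho> \<delta>" .
    have "?N (fhat - fdag) \<ge> 0"
      by (simp add: wavelet_norm_def lq_norm_def)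
    then have "?N (fhat - fdag) \<le> C * log_rate s \<rho> \<delta>"
      using bound r by (simp add: powr_powr)
    \<comment> \<open>The reference Besov norm links the wavelet norm to \<open>N0\<close>, at the
      price of the factor \<open>b / a\<close>.\<close>
    with a(2)[OF d] have "besov_norm \<eta> 0 p (ereal r) (fhat - fdag) \<le> C * log_rate s \<rho> \<delta> / a"
      using a(1) by (simp add: pos_le_divide_eq mult.commute)
    then have "b * besov_norm \<eta> 0 p (ereal r) (fhat - fdag) \<le> b * (C * log_rate s \<rho> \<delta> / a)"
      using b(1) by (intro mult_left_mono) auto
    with b(2)[OF d] show ?thesis by (simp add: field_simps)
  qed
  show ?thesis
  proof (rule exI[of _ "b / a * C"], intro conjI allI impI)
    fix \<rho> :: real assume \<rho>: "\<rho> > 0"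
    \<comment> \<open>Below \<open>\<rho> / 6\<close> the bound on the index function applies and
      the logarithm is positive.\<close>
    then have "\<forall>\<^sub>F \<delta> in at_right 0. \<delta> \<in> {0<..<\<rho> / 6}"
      by (intro eventually_at_right_real) simp
    then show "\<forall>\<^sub>F \<delta> in at_right 0. \<forall>fdag gobs F \<alpha> fhat.
        fdag \<in> D \<and> L2_fun gobs \<and> Lp_norm 2 (gobs - T fdag) \<le> \<delta> \<and>
        subgradient ?V N0 P fdag F \<and>
        source_condition D T P (index_fun c0 \<rho> s r r) fdag F \<and> \<alpha> > 0 \<and>
        - 1 / (4 * \<alpha>) \<in> subdifferential (\<lambda>\<tau>. - index_fun c0 \<rho> s r r \<tau>) (4 * \<delta>\<^sup>2) \<and>
        tikhonov_minimizer D T P \<alpha> gobs fhat \<longrightarrow> N0 (fhat - fdag) \<le> b / a * C * log_rate s \<rho> \<delta>"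
    proof eventually_elim
      case (elim \<delta>)
      then have "\<delta> > 0" "6 * \<delta> \<le> \<rho>" by auto
      from rate[OF \<rho> this] show ?case by blast
    qed
  qed (use a b C in simp)
qed

theorem theorem5p3:
  fixes tbar p s :: real and q :: ereal
    and \<eta> :: "real^'d \<Rightarrow> real"
    and N0 Ns :: "'d distribution \<Rightarrow> real"
    and T :: "'d distribution \<Rightarrow> real^'d \<Rightarrow> real"
  assumes "tbar > 0" and "1 \<le> p" and "p \<le> 2" and "1 \<le> q" and "s > 0"
    and "lp_cutoff \<eta>"
    and "equivalent_besov_norm \<eta> 0 p q N0"
    and "equivalent_besov_norm \<eta> s p \<infinity> Ns"
    and "heat_operator tbar (besov_space \<eta> 0 p q) T"
  shows
    "(\<forall>\<rho>>0. \<not> (\<exists>R. reconstruction_method (besov_space \<eta> 0 p q) R \<and>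
        little_o_at_0 (\<lambda>\<delta>. worst_case_error N0 (besov_space \<eta> s p \<infinity>) Ns T \<rho> \<delta> R)
          (log_rate s \<rho>)))
     \<and>
     (1 < p \<and> 2 \<le> q \<and> q < \<infinity> \<longrightarrow>
       \<comment> \<open>the Tikhonov rate is attained\<close>
       (\<forall>(I :: nat \<Rightarrow> 'l set) (W :: nat \<Rightarrow> 'l \<Rightarrow> real^'d \<Rightarrow> real) (D :: 'd distribution set) c0 r P.
          orthonormal_system I W \<and>
          generates_besov \<eta> I W 0 p q \<and> generates_besov \<eta> I W s p \<infinity> \<and>
          admissible_domain (besov_space \<eta> 0 p q) N0 D \<and> c0 > 0 \<and>
          r = max 2 (max p (real_of_ereal q)) \<and>
          P = penalty (wavelet_norm \<eta> I W 0 p q) r \<longrightarrow>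
          (\<exists>c>0. \<forall>\<rho>>0. \<forall>\<^sub>F \<delta> in at_right 0.
             \<forall>fdag gobs F \<alpha> fhat.
               fdag \<in> D \<inter> besov_space \<eta> s p \<infinity> \<and> Ns fdag \<le> \<rho> \<and>
               L2_fun gobs \<and> Lp_norm 2 (gobs - T fdag) \<le> \<delta> \<and>
               subgradient (besov_space \<eta> 0 p q) N0 P fdag F \<and>
               source_condition D T P (index_fun c0 \<rho> s (real_of_ereal q) r) fdag F \<and>
               \<alpha> > 0 \<and>
               - 1 / (4 * \<alpha>) \<in>
                 subdifferential (\<lambda>\<tau>. - index_fun c0 \<rho> s (real_of_ereal q) r \<tau>) (4 * \<delta>\<^sup>2) \<and>
               tikhonov_minimizer D T P \<alpha> gobs fhat
               \<longrightarrow> N0 (fhat - fdag) \<le> c * log_rate s \<rho> \<delta>))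
       \<and>
       \<comment> \<open>no method, even with a parameter depending on the noise level, has a faster rate\<close>
       (\<forall>\<rho>>0. \<not> (\<exists>R. (\<forall>\<delta>>0. reconstruction_method (besov_space \<eta> 0 p q) (R \<delta>)) \<and>
          little_o_at_0 (\<lambda>\<delta>. worst_case_error N0 (besov_space \<eta> s p \<infinity>) Ns T \<rho> \<delta> (R \<delta>))
            (log_rate s \<rho>))))"
proof (intro conjI impI allI)
  fix \<rho> :: real assume \<rho>: "\<rho> > 0"
  show "\<not> (\<exists>R. reconstruction_method (besov_space \<eta> 0 p q) R \<and>
      little_o_at_0 (\<lambda>\<delta>. worst_case_error N0 (besov_space \<eta> s p \<infinity>) Ns T \<rho> \<delta> R) (log_rate s \<rho>))"
    using no_faster_rate[OF assms \<rho>, of "\<lambda>_. R" for R] by blast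
next
  fix \<rho> :: real assume \<rho>: "\<rho> > 0"
  show "\<not> (\<exists>R. (\<forall>\<delta>>0. reconstruction_method (besov_space \<eta> 0 p q) (R \<delta>)) \<and>
      little_o_at_0 (\<lambda>\<delta>. worst_case_error N0 (besov_space \<eta> s p \<infinity>) Ns T \<rho> \<delta> (R \<delta>)) (log_rate s \<rho>))"
    using no_faster_rate[OF assms \<rho>] by blast
next
  fix I :: "nat \<Rightarrow> 'l set" and W :: "nat \<Rightarrow> 'l \<Rightarrow> real^'d \<Rightarrow> real" and D :: "'d distribution set"
    and c0 r :: real and P
  assume pq: "1 < p \<and> 2 \<le> q \<and> q < \<infinity>"
    and H: "orthonormal_system I W \<and> generates_besov \<eta> I W 0 p q \<and> generates_besov \<eta> I W s p \<infinity> \<and>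
      admissible_domain (besov_space \<eta> 0 p q) N0 D \<and> c0 > 0 \<and>
      r = max 2 (max p (real_of_ereal q)) \<and> P = penalty (wavelet_norm \<eta> I W 0 p q) r"
  from pq have "q = ereal (real_of_ereal q)" by (cases q) auto
  moreover from this pq have "2 \<le> real_of_ereal q" by (cases q) auto
  \<comment> \<open>As p \<le> 2 \<le> q, the maximum defining \<open>r\<close> is q itself, so the
    penalty is the q-th power of a norm with summation index q and decouples over the
    levels.\<close>
  ultimately have q: "q = ereal r" "2 \<le> r" "real_of_ereal q = r"
    using H \<open>p \<le> 2\<close> by auto
  have D: "D \<subseteq> besov_space \<eta> 0 p (ereal r)" "c0 > 0"
      "P = penalty (wavelet_norm \<eta> I W 0 p (ereal r)) r"
    and W: "orthonormal_system I W" "generates_besov \<eta> I W 0 p (ereal r)"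
    using H unfolding admissible_domain_def q(1) by blast+
  have "\<exists>c>0. \<forall>\<rho>>0. \<forall>\<^sub>F \<delta> in at_right 0. \<forall>fdag gobs F \<alpha> fhat.
    fdag \<in> D \<and> L2_fun gobs \<and> Lp_norm 2 (gobs - T fdag) \<le> \<delta> \<and>
    subgradient (besov_space \<eta> 0 p (ereal r)) N0 P fdag F \<and>
    source_condition D T P (index_fun c0 \<rho> s r r) fdag F \<and> \<alpha> > 0 \<and>
    - 1 / (4 * \<alpha>) \<in> subdifferential (\<lambda>\<tau>. - index_fun c0 \<rho> s r r \<tau>) (4 * \<delta>\<^sup>2) \<and>
    tikhonov_minimizer D T P \<alpha> gobs fhat \<longrightarrow> N0 (fhat - fdag) \<le> c * log_rate s \<rho> \<delta>"
    by (rule tikhonov_rate[OF assms(1) _ assms(3) q(2) assms(5) assms(7,9)[unfolded q(1)] W D])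
      (use pq in simp)
  then obtain c where c: "c > 0" and *: "\<And>\<rho>. \<rho> > 0 \<Longrightarrow> \<forall>\<^sub>F \<delta> in at_right 0. \<forall>fdag gobs F \<alpha> fhat.
    fdag \<in> D \<and> L2_fun gobs \<and> Lp_norm 2 (gobs - T fdag) \<le> \<delta> \<and>
    subgradient (besov_space \<eta> 0 p (ereal r)) N0 P fdag F \<and>
    source_condition D T P (index_fun c0 \<rho> s r r) fdag F \<and> \<alpha> > 0 \<and>
    - 1 / (4 * \<alpha>) \<in> subdifferential (\<lambda>\<tau>. - index_fun c0 \<rho> s r r \<tau>) (4 * \<delta>\<^sup>2) \<and>
    tikhonov_minimizer D T P \<alpha> gobs fhat \<longrightarrow> N0 (fhat - fdag) \<le> c * log_rate s \<rho> \<delta>"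
    by blast
  show "\<exists>c>0. \<forall>\<rho>>0. \<forall>\<^sub>F \<delta> in at_right 0. \<forall>fdag gobs F \<alpha> fhat.
      fdag \<in> D \<inter> besov_space \<eta> s p \<infinity> \<and> Ns fdag \<le> \<rho> \<and>
      L2_fun gobs \<and> Lp_norm 2 (gobs - T fdag) \<le> \<delta> \<and>
      subgradient (besov_space \<eta> 0 p q) N0 P fdag F \<and>
      source_condition D T P (index_fun c0 \<rho> s (real_of_ereal q) r) fdag F \<and> \<alpha> > 0 \<and>
      - 1 / (4 * \<alpha>) \<in> subdifferential (\<lambda>\<tau>. - index_fun c0 \<rho> s (real_of_ereal q) r \<tau>) (4 * \<delta>\<^sup>2) \<and>
      tikhonov_minimizer D T P \<alpha> gobs fhat \<longrightarrow> N0 (fhat - fdag) \<le> c * log_rate s \<rho> \<delta>"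
    unfolding q(3)
  proof (intro exI[of _ c] conjI c allI impI)
    fix \<rho> :: real assume "\<rho> > 0"
    from *[OF this] show "\<forall>\<^sub>F \<delta> in at_right 0. \<forall>fdag gobs F \<alpha> fhat.
      fdag \<in> D \<inter> besov_space \<eta> s p \<infinity> \<and> Ns fdag \<le> \<rho> \<and>
      L2_fun gobs \<and> Lp_norm 2 (gobs - T fdag) \<le> \<delta> \<and>
      subgradient (besov_space \<eta> 0 p q) N0 P fdag F \<and>
      source_condition D T P (index_fun c0 \<rho> s r r) fdag F \<and> \<alpha> > 0 \<and>
      - 1 / (4 * \<alpha>) \<in> subdifferential (\<lambda>\<tau>. - index_fun c0 \<rho> s r r \<tau>) (4 * \<delta>\<^sup>2) \<and>
      tikhonov_minimizer D T P \<alpha> gobs fhat \<longrightarrow> N0 (fhat - fdag) \<le> c * log_rate s \<rho> \<delta>"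
      unfolding q(1) by (rule eventually_mono) blast
  qed
qed

end
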